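(* In the Traditional Model, given arbitrary real or complex inputs $x_1,\dots,x_n,y_1,\dots,y_n$ with $x_i+y_j\ne 0$ for all $i,j$, the determinant of the Cauchy matrix $C_{ij}=1/(x_i+y_j)$ and every minor of $C$ can be computed accurately and efficiently. Moreover, a version of Gaussian elimination computes each entry of the LU decomposition of $C$ accurately in about the same time as classical Gaussian elimination (i.e. with $O(n^3)$ operations).
   Context: Traditional Model (TM): inputs are arbitrary real (or complex) numbers, given exactly; the floating point result of an operation $\otimes\in\{+,-,\times,\div\}$ is $fl(a\otimes b)=(a\otimes b)(1+\delta)$, where $\delta$ is an arbitrary real (or complex) number with $|\delta|\le\epsilon$, $\epsilon\ll 1$ being the machine precision. The size of the input is the number of floating point words needed to describe it. "Accurately" means each output component has small relative error (less than $1$, no matter how tiny the exact value is; zero must be computed exactly), for all inputs and all choices of the $\delta$'s. "Efficiently" means the number of operations is bounded by a polynomial in the input size. $\epsilon$ is assumed sufficiently small relative to the number of operations performed. *)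

theory Defs
  imports
    Complex_Main
    "HOL-Library.Landau_Symbols"
    "HOL-Computational_Algebra.Polynomial"
    "Jordan_Normal_Form.Determinant"
    "Jordan_Normal_Form.DL_Submatrix"
begin

section \<open>Algorithms in the Traditional Model\<close>

text \<open>
  An algorithm is a term of the small loop language below. The syntax does not mention the type
  of numbers and contains no dimension, so a single program serves all sizes and both the real
  and the complex numbers. Numbers are only accessible through the four rounded operations,
  the literals 0 and 1, and exact copying. There is no branching on data; existence of an
  algorithm in this language therefore gives existence in any model that also has branching.
\<close>

datatype iexp = INum nat | IVar string | IElem string iexp | IAdd iexp iexp

datatype fop = Add | Sub | Mul | Div

datatype fexp = Zero | One | Elem string "iexp list" | Bin fop fexp fexp

text \<open>\<open>For v lo hi c\<close> runs \<open>c\<close> for \<open>v = lo, \<dots>, hi - 1\<close>.\<close>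

datatype com =
    Assign string "iexp list" fexp
  | Seq com com
  | For string iexp iexp com

text \<open>
  \<open>ivar\<close> holds the index variables, \<open>ivec\<close> read-only vectors of indices, and \<open>fmem\<close> arrays of
  numbers of any rank; a scalar is an array entry with the empty index list.
\<close>

record 'a state =
  ivar :: "string \<Rightarrow> nat"
  ivec :: "string \<Rightarrow> nat \<Rightarrow> nat"
  fmem :: "string \<times> nat list \<Rightarrow> 'a"

primrec ival :: "'a state \<Rightarrow> iexp \<Rightarrow> nat" where
  "ival s (INum k) = k"
| "ival s (IVar v) = ivar s v"
| "ival s (IElem a e) = ivec s a (ival s e)"
| "ival s (IAdd e e') = ival s e + ival s e'"

fun exact_op :: "fop \<Rightarrow> 'a::field \<Rightarrow> 'a \<Rightarrow> 'a option" where
  "exact_op Add a b = Some (a + b)"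
| "exact_op Sub a b = Some (a - b)"
| "exact_op Mul a b = Some (a * b)"
| "exact_op Div a b = (if b = 0 then None else Some (a / b))"

text \<open>
  The sequence \<open>\<delta>\<close> supplies the rounding errors: the \<open>k\<close>-th arithmetic operation that a run
  performs returns its exact result times \<open>1 + \<delta> k\<close>. The counter threaded through the
  semantics is the number of arithmetic operations performed so far. Division by zero aborts
  the run (\<open>None\<close>).
\<close>

primrec feval :: "(nat \<Rightarrow> 'a::field) \<Rightarrow> 'a state \<Rightarrow> fexp \<Rightarrow> nat \<Rightarrow> ('a \<times> nat) option" where
  "feval \<delta> s Zero k = Some (0, k)"
| "feval \<delta> s One k = Some (1, k)"
| "feval \<delta> s (Elem a is) k = Some (fmem s (a, map (ival s) is), k)"
| "feval \<delta> s (Bin f e e') k =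
     Option.bind (feval \<delta> s e k) (\<lambda>(u, k1).
     Option.bind (feval \<delta> s e' k1) (\<lambda>(v, k2).
     Option.bind (exact_op f u v) (\<lambda>w. Some (w * (1 + \<delta> k2), Suc k2))))"

primrec run :: "(nat \<Rightarrow> 'a::field) \<Rightarrow> com \<Rightarrow> 'a state \<times> nat \<Rightarrow> ('a state \<times> nat) option" where
  "run \<delta> (Assign a is e) = (\<lambda>(s, k).
     Option.bind (feval \<delta> s e k) (\<lambda>(v, k').
       Some (s\<lparr>fmem := (fmem s)((a, map (ival s) is) := v)\<rparr>, k')))"
| "run \<delta> (Seq c c') = (\<lambda>r. Option.bind (run \<delta> c r) (run \<delta> c'))"
| "run \<delta> (For v lo hi c) = (\<lambda>(s, k).
     fold (\<lambda>i r. Option.bind r (\<lambda>(t, l). run \<delta> c (t\<lparr>ivar := (ivar t)(v := i)\<rparr>, l)))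
       [ival s lo..<ival s hi] (Some (s, k)))"

section \<open>Accuracy\<close>

text \<open>
  A problem is a set of instances \<open>(n, s, out)\<close>: the dimension, an initial state holding the
  input, and the memory cells in which the result is expected together with its exact value.
\<close>

type_synonym 'a problem = "(nat \<times> 'a state \<times> ((string \<times> nat list) \<times> 'a) set) set"

text \<open>
  The run must not abort and performs \<open>N \<le> T n\<close> arithmetic operations. Every relative accuracy
  \<open>\<eta> < 1\<close> has to be reached as soon as \<open>\<epsilon> * N\<close> is below a constant that depends on \<open>\<eta>\<close> but
  neither on the dimension nor on the input, i.e. as soon as \<open>\<epsilon>\<close> is small relative to the number
  of operations performed. An exact value 0 must then be computed exactly.
\<close>

definition computes_accurately ::
    "com \<Rightarrow> (nat \<Rightarrow> nat) \<Rightarrow> 'a::real_normed_field problem \<Rightarrow> bool" where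
  "computes_accurately P T prob \<longleftrightarrow>
     (\<forall>\<eta>::real. 0 < \<eta> \<and> \<eta> < 1 \<longrightarrow>
       (\<exists>c>0. \<forall>(n, s, out) \<in> prob. \<forall>\<epsilon> \<delta>. 0 \<le> \<epsilon> \<and> \<epsilon> \<le> c \<and> (\<forall>k. norm (\<delta> k) \<le> \<epsilon>) \<longrightarrow>
         (\<exists>t N. run \<delta> P (s, 0) = Some (t, N) \<and> N \<le> T n \<and>
           (\<epsilon> * real N \<le> c \<longrightarrow>
             (\<forall>(loc, v) \<in> out. norm (fmem t loc - v) \<le> \<eta> * norm v)))))"

section \<open>Cauchy matrices\<close>

text \<open>All indices start at 0.\<close>

definition cauchy_mat :: "nat \<Rightarrow> (nat \<Rightarrow> 'a::field) \<Rightarrow> (nat \<Rightarrow> 'a) \<Rightarrow> 'a mat" where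
  "cauchy_mat n x y = mat n n (\<lambda>(i, j). 1 / (x i + y j))"

text \<open>
  Memory outside the input cells is arbitrary.
\<close>

definition cauchy_input ::
    "nat \<Rightarrow> (nat \<Rightarrow> 'a::field) \<Rightarrow> (nat \<Rightarrow> 'a) \<Rightarrow> 'a state \<Rightarrow> bool" where
  "cauchy_input n x y s \<longleftrightarrow>
     (\<forall>i<n. \<forall>j<n. x i + y j \<noteq> 0) \<and>
     ivar s ''n'' = n \<and>
     (\<forall>i<n. fmem s (''x'', [i]) = x i \<and> fmem s (''y'', [i]) = y i)"

definition cauchy_det_problem :: "'a::field problem" where
  "cauchy_det_problem =
     {(n, s, {((''d'', []), det (cauchy_mat n x y))}) | n x y s. cauchy_input n x y s}"

text \<open>
  The minor to be computed is specified by the index vectors \<open>''r''\<close> and \<open>''c''\<close>, which list the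
  row set \<open>I\<close> and the column set \<open>J\<close> in increasing order (\<open>pick I a\<close> is the \<open>a\<close>-th element
  of \<open>I\<close>).
\<close>

definition cauchy_minor_problem :: "'a::field problem" where
  "cauchy_minor_problem =
     {(n, s, {((''d'', []), det (submatrix (cauchy_mat n x y) I J))}) | n x y s I J.
        cauchy_input n x y s \<and> I \<subseteq> {..<n} \<and> J \<subseteq> {..<n} \<and> card I = card J \<and>
        ivar s ''m'' = card I \<and>
        (\<forall>a<card I. ivec s ''r'' a = pick I a \<and> ivec s ''c'' a = pick J a)}"

definition LU_decomposition :: "nat \<Rightarrow> 'a::field mat \<Rightarrow> 'a mat \<times> 'a mat \<Rightarrow> bool" where
  "LU_decomposition n A = (\<lambda>(L, U).
     L \<in> carrier_mat n n \<and> U \<in> carrier_mat n n \<and>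
     (\<forall>i<n. L $$ (i, i) = 1) \<and> (\<forall>i<n. \<forall>j<n. i < j \<longrightarrow> L $$ (i, j) = 0) \<and>
     upper_triangular U \<and> A = L * U)"

text \<open>
  The inputs are those for which the LU decomposition of \<open>C\<close> exists and is unique; this includes
  every nonsingular Cauchy matrix. The nontrivial entries of \<open>L\<close> and \<open>U\<close> share one array, as
  usual: strictly below the diagonal those of \<open>L\<close>, elsewhere those of \<open>U\<close>.
\<close>

definition cauchy_LU_problem :: "'a::field problem" where
  "cauchy_LU_problem =
     {(n, s, {((''A'', [i, j]), if j < i then L $$ (i, j) else U $$ (i, j)) | i j. i < n \<and> j < n})
        | n x y s L U.
        cauchy_input n x y s \<and>
        LU_decomposition n (cauchy_mat n x y) (L, U) \<and>
        (\<forall>L' U'. LU_decomposition n (cauchy_mat n x y) (L', U') \<longrightarrow> L' = L \<and> U' = U)}"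

section \<open>Gaussian elimination\<close>

text \<open>
  Gaussian elimination without pivoting on the array \<open>''A''\<close>, preceded by forming \<open>C\<close>. The
  expression \<open>upd\<close> is the one that overwrites the entry \<open>(i, j)\<close> in step \<open>k\<close> of the inner loop,
  at a time when \<open>A[i,k]\<close> already holds the multiplier. A version of Gaussian elimination is
  obtained by changing this expression, the rest of the algorithm being kept; the classical
  choice is \<open>A[i,j] - A[i,k] * A[k,j]\<close>. As \<open>upd\<close> is a fixed expression, each update takes a
  number of operations independent of \<open>n\<close>.
\<close>

definition gauss_elim :: "fexp \<Rightarrow> com" where
  "gauss_elim upd =
     (let n = IVar ''n''; i = IVar ''i''; j = IVar ''j''; k = IVar ''k'' in
      Seq
        (For ''i'' (INum 0) n (For ''j'' (INum 0) n
          (Assign ''A'' [i, j] (Bin Div One (Bin Add (Elem ''x'' [i]) (Elem ''y'' [j]))))))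
        (For ''k'' (INum 0) n
          (Seq
            (For ''i'' (IAdd k (INum 1)) n
              (Assign ''A'' [i, k] (Bin Div (Elem ''A'' [i, k]) (Elem ''A'' [k, k]))))
            (For ''i'' (IAdd k (INum 1)) n (For ''j'' (IAdd k (INum 1)) n
              (Assign ''A'' [i, j] upd))))))"

end

theory Submission
  imports Defs
begin

text \<open>
  The entry \<open>(i, j)\<close> of the Schur complement after \<open>k\<close> elimination steps on \<open>1 / (x i + y j)\<close> is
  \<open>1 / (x i + y j)\<close> times the product over \<open>l < k\<close> of
  \<open>(x i - x l) (y j - y l) / ((x l + y j) (x i + y l))\<close>. Step \<open>k\<close> can therefore multiply by one such
  factor where classical elimination subtracts. Sums and differences are then only formed from
  inputs, which are exact, so a computed value is the exact one times a product of factors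
  \<open>1 + \<delta>\<close> and their inverses. The determinant is the product of the pivots, and a minor is
  again a Cauchy determinant. Uniqueness of the LU decomposition makes all pivots but the last
  nonzero: a zero pivot \<open>U(k, k)\<close> with \<open>k < n - 1\<close> would allow adding column \<open>k + 1\<close> of \<open>L\<close> to
  column \<open>k\<close> while subtracting row \<open>k\<close> of \<open>U\<close> from row \<open>k + 1\<close>.
\<close>

section \<open>Accumulated rounding factors\<close>

inductive rnd :: "real \<Rightarrow> nat \<Rightarrow> 'a::real_normed_field \<Rightarrow> bool" for \<epsilon> where
  rnd_one: "rnd \<epsilon> 0 1"
| rnd_mult: "rnd \<epsilon> k u \<Longrightarrow> norm d \<le> \<epsilon> \<Longrightarrow> rnd \<epsilon> (Suc k) (u * (1 + d))"
| rnd_div: "rnd \<epsilon> k u \<Longrightarrow> norm d \<le> \<epsilon> \<Longrightarrow> rnd \<epsilon> (Suc k) (u / (1 + d))"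

lemma rnd_times: "rnd \<epsilon> l v \<Longrightarrow> rnd \<epsilon> k u \<Longrightarrow> rnd \<epsilon> (k + l) (u * v)"
proof (induction rule: rnd.induct)
  case rnd_one
  then show ?case by simp
next
  case (rnd_mult l v d)
  then show ?case using rnd.rnd_mult[of \<epsilon> "k + l" "u * v" d] by (simp add: mult.assoc)
next
  case (rnd_div l v d)
  then show ?case using rnd.rnd_div[of \<epsilon> "k + l" "u * v" d] by simp
qed

lemma rnd_inverse: "rnd \<epsilon> k u \<Longrightarrow> rnd \<epsilon> k (inverse u)"
proof (induction rule: rnd.induct)
  case rnd_one
  then show ?case using rnd.rnd_one by simp
next
  case (rnd_mult k u d)
  then show ?case using rnd.rnd_div[of \<epsilon> k "inverse u" d] by (simp add: field_simps)
next
  case (rnd_div k u d)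
  then show ?case using rnd.rnd_mult[of \<epsilon> k "inverse u" d] by (simp add: field_simps)
qed

lemma rnd_mono:
  assumes "rnd \<epsilon> k u" "k \<le> l" "0 \<le> \<epsilon>"
  shows "rnd \<epsilon> l u"
proof -
  \<comment> \<open>Pads with \<open>m\<close> factors \<open>1 + 0\<close>.\<close>
  have "rnd \<epsilon> (k + m) u" for m
    using assms(1,3) rnd_mult[of \<epsilon> _ u 0] by (induction m) auto
  then show ?thesis using assms(2) le_Suc_ex by metis
qed

lemma one_plus_nonzero:
  fixes d :: "'a::real_normed_field"
  assumes "norm d < 1"
  shows "1 + d \<noteq> 0"
proof
  assume "1 + d = 0"
  then have "d = - 1" by (simp add: eq_neg_iff_add_eq_0 add.commute)
  with assms show False by simp
qed

lemma rnd_nonzero: "rnd \<epsilon> k u \<Longrightarrow> \<epsilon> < 1 \<Longrightarrow> u \<noteq> 0"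
  by (induction rule: rnd.induct) (auto dest: one_plus_nonzero order_le_less_trans)

text \<open>The base \<open>1 / (1 - \<epsilon>)\<close> dominates both
  \<open>1 + \<epsilon>\<close> and \<open>1 / norm (1 + d)\<close>, so one geometric bound covers
  factors of either kind.\<close>

lemma norm_rnd_diff_le:
  assumes "rnd \<epsilon> k u" "0 \<le> \<epsilon>" "\<epsilon> < 1"
  shows "norm (u - 1) \<le> (1 / (1 - \<epsilon>)) ^ k - 1"
  using assms(1)
proof (induction rule: rnd.induct)
  case rnd_one
  then show ?case by simp
next
  case (rnd_mult k u d)
  let ?q = "1 / (1 - \<epsilon>)"
  have q: "1 + \<epsilon> \<le> ?q" using assms by (simp add: field_simps)
  have "u * (1 + d) - 1 = (u - 1) * (1 + d) + d" by (simp add: algebra_simps)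
  then have "norm (u * (1 + d) - 1) \<le> norm (u - 1) * norm (1 + d) + norm d"
    by (metis norm_mult norm_triangle_ineq)
  also have "\<dots> \<le> (?q ^ k - 1) * (1 + \<epsilon>) + \<epsilon>"
    using rnd_mult norm_triangle_ineq[of 1 d] assms
    by (intro add_mono mult_mono) (auto intro: order_trans[OF norm_ge_zero])
  also have "\<dots> = ?q ^ k * (1 + \<epsilon>) - 1" by (simp add: algebra_simps)
  also have "\<dots> \<le> ?q ^ k * ?q - 1"
    using mult_left_mono[OF q, of "?q ^ k"] assms by simp
  finally show ?case by (simp add: mult.commute)
next
  case (rnd_div k u d)
  let ?q = "1 / (1 - \<epsilon>)"
  have d: "1 + d \<noteq> 0" using one_plus_nonzero rnd_div assms by force
  have lower: "1 - \<epsilon> \<le> norm (1 + d)"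
    using norm_triangle_ineq2[of 1 "- d"] rnd_div by simp
  have "u / (1 + d) - 1 = ((u - 1) - d) / (1 + d)" using d by (simp add: field_simps)
  then have "norm (u / (1 + d) - 1) = norm ((u - 1) - d) / norm (1 + d)"
    by (simp add: norm_divide)
  also have "\<dots> \<le> ((?q ^ k - 1) + \<epsilon>) / (1 - \<epsilon>)"
    using lower rnd_div assms norm_triangle_ineq4[of "u - 1" d]
    by (intro frac_le) (auto intro: order_trans)
  also have "\<dots> = ?q ^ Suc k - 1" using assms by (simp add: field_simps)
  finally show ?case .
qed

lemma rnd_small:
  assumes "0 < \<eta>"
  shows "\<exists>c>0. c < 1 \<and> (\<forall>\<epsilon> k u. 0 \<le> \<epsilon> \<longrightarrow> \<epsilon> \<le> c \<longrightarrow> \<epsilon> * real k \<le> c \<longrightarrow>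
    rnd \<epsilon> k (u::'a::real_normed_field) \<longrightarrow> norm (u - 1) \<le> \<eta>)"
proof (intro exI conjI allI impI)
  let ?c = "min (1/2) (ln (1 + \<eta>) / 2)"
  show "0 < ?c" "?c < 1" using assms by auto
  \<comment> \<open>The cap \<open>1/2\<close> gives
    \<open>1 / (1 - \<epsilon>) \<le> 1 + 2 * \<epsilon>\<close>, so the \<open>k\<close>-th power
    is at most \<open>exp (2 * \<epsilon> * k)\<close>; the logarithm then makes this at most
    \<open>1 + \<eta>\<close>.\<close>
  fix \<epsilon> k and u :: 'a
  assume e: "0 \<le> \<epsilon>" "\<epsilon> \<le> ?c" "\<epsilon> * real k \<le> ?c" "rnd \<epsilon> k u"
  have "\<epsilon> * \<epsilon> \<le> \<epsilon> * (1/2)" using e by (intro mult_left_mono) auto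
  then have "1 / (1 - \<epsilon>) \<le> 1 + 2 * \<epsilon>" using e by (simp add: field_simps)
  also have "\<dots> \<le> exp (2 * \<epsilon>)" by (rule exp_ge_add_one_self)
  finally have "(1 / (1 - \<epsilon>)) ^ k \<le> exp (2 * \<epsilon>) ^ k"
    using e by (intro power_mono) auto
  also have "\<dots> = exp (2 * (\<epsilon> * real k))"
    by (simp add: exp_of_nat_mult[symmetric] mult_ac)
  also have "\<dots> \<le> exp (ln (1 + \<eta>))" using e by (subst exp_le_cancel_iff) auto
  also have "\<dots> = 1 + \<eta>" using assms by simp
  finally show "norm (u - 1) \<le> \<eta>" using norm_rnd_diff_le[OF e(4) e(1)] e by auto
qed

text \<open>The error is multiplicative, so \<open>w\<close> vanishes whenever \<open>v\<close> does
  and exact zeros need no separate treatment.\<close>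

definition approx :: "real \<Rightarrow> nat \<Rightarrow> 'a::real_normed_field \<Rightarrow> 'a \<Rightarrow> bool" where
  "approx \<epsilon> m v w \<longleftrightarrow> (\<exists>u. rnd \<epsilon> m u \<and> w = v * u)"

lemma approx_refl: "approx \<epsilon> 0 v v"
  unfolding approx_def using rnd_one by fastforce

lemma approx_mono: "approx \<epsilon> m v w \<Longrightarrow> m \<le> m' \<Longrightarrow> 0 \<le> \<epsilon> \<Longrightarrow> approx \<epsilon> m' v w"
  unfolding approx_def using rnd_mono by blast

lemma approx_mult:
  assumes "approx \<epsilon> m v v'" "approx \<epsilon> l w w'"
  shows "approx \<epsilon> (m + l) (v * w) (v' * w')"
proof -
  obtain a b where "rnd \<epsilon> m a" "rnd \<epsilon> l b" "v' = v * a" "w' = w * b"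
    using assms unfolding approx_def by blast
  then show ?thesis unfolding approx_def using rnd_times[of \<epsilon> l b m a]
    by (intro exI[of _ "a * b"]) (simp add: mult_ac)
qed

lemma approx_divide:
  assumes "approx \<epsilon> m v v'" "approx \<epsilon> l w w'"
  shows "approx \<epsilon> (m + l) (v / w) (v' / w')"
proof -
  obtain b where "rnd \<epsilon> l b" "w' = w * b"
    using assms unfolding approx_def by blast
  then have "approx \<epsilon> l (inverse w) (inverse w')"
    unfolding approx_def using rnd_inverse by (metis inverse_mult_distrib)
  then show ?thesis using approx_mult[OF assms(1)] by (simp add: divide_inverse)
qed

lemma approx_round: "approx \<epsilon> m v w \<Longrightarrow> norm d \<le> \<epsilon> \<Longrightarrow> approx \<epsilon> (Suc m) v (w * (1 + d))"
  unfolding approx_def using rnd_mult by (metis mult.assoc)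

text \<open>Guarantees that a rounded divisor is nonzero when the exact one is, so that the run does
  not abort.\<close>

lemma approx_nonzero: "approx \<epsilon> m v w \<Longrightarrow> v \<noteq> 0 \<Longrightarrow> \<epsilon> < 1 \<Longrightarrow> w \<noteq> 0"
  unfolding approx_def using rnd_nonzero by (metis no_zero_divisors)

lemma approx_small:
  assumes "0 < \<eta>"
  shows "\<exists>c>0. c < 1 \<and> (\<forall>\<epsilon> k v w. 0 \<le> \<epsilon> \<longrightarrow> \<epsilon> \<le> c \<longrightarrow> \<epsilon> * real k \<le> c \<longrightarrow>
    approx \<epsilon> k v (w::'a::real_normed_field) \<longrightarrow> norm (w - v) \<le> \<eta> * norm v)"
proof -
  obtain c where c: "c > 0" "c < 1" and small: "\<And>\<epsilon> k u. 0 \<le> \<epsilon> \<Longrightarrow> \<epsilon> \<le> c \<Longrightarrow>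
    \<epsilon> * real k \<le> c \<Longrightarrow> rnd \<epsilon> k (u::'a) \<Longrightarrow> norm (u - 1) \<le> \<eta>"
    using rnd_small[OF assms, where ?'a = 'a] by blast
  have "norm (w - v) \<le> \<eta> * norm v"
    if e: "0 \<le> \<epsilon>" "\<epsilon> \<le> c" "\<epsilon> * real k \<le> c" and a: "approx \<epsilon> k v w"
    for \<epsilon> k and v w :: 'a
  proof -
    obtain u where u: "rnd \<epsilon> k u" "w = v * u" using a unfolding approx_def by blast
    then have "w - v = v * (u - 1)" by (simp add: algebra_simps)
    then show ?thesis using mult_left_mono[OF small[OF e u(1)], of "norm v"]
      by (simp add: norm_mult mult.commute)
  qed
  then show ?thesis using c by blast
qed

section \<open>Schur complements of a Cauchy matrix\<close>

definition schur_factor :: "(nat \<Rightarrow> 'a::field) \<Rightarrow> (nat \<Rightarrow> 'a) \<Rightarrow> nat \<Rightarrow> nat \<Rightarrow> nat \<Rightarrow> 'a" where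
  "schur_factor x y l i j = ((x i - x l) * (y j - y l)) / ((x l + y j) * (x i + y l))"

definition schur :: "(nat \<Rightarrow> 'a::field) \<Rightarrow> (nat \<Rightarrow> 'a) \<Rightarrow> nat \<Rightarrow> nat \<Rightarrow> nat \<Rightarrow> 'a" where
  "schur x y k i j = 1 / (x i + y j) * (\<Prod>l<k. schur_factor x y l i j)"

lemma schur_0: "schur x y 0 i j = 1 / (x i + y j)"
  by (simp add: schur_def)

lemma schur_Suc: "schur x y (Suc k) i j = schur x y k i j * schur_factor x y k i j"
  by (simp add: schur_def mult.assoc)

text \<open>The factor with \<open>l = i\<close> contains \<open>x i - x i\<close>. The closed
  formula thus extends to eliminated rows, where it supplies the zeros of \<open>L\<close> above the
  diagonal and the vanishing remainder after \<open>n\<close> steps.\<close>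

lemma schur_row_zero: "i < k \<Longrightarrow> schur x y k i j = 0"
  unfolding schur_def schur_factor_def by (auto intro!: bexI[of _ i] simp: prod_zero_iff)

lemma schur_col_zero: "j < k \<Longrightarrow> schur x y k i j = 0"
  unfolding schur_def schur_factor_def by (auto intro!: bexI[of _ j] simp: prod_zero_iff)

text \<open>The product separates into a part depending on \<open>i\<close> and a part depending on
  \<open>j\<close>, so a Schur complement is a Cauchy matrix with scaled rows and columns. Scaling
  is compatible with elimination, which reduces the claim to one step on an unscaled Cauchy
  matrix.\<close>

lemma schur_elimination:
  fixes x y :: "nat \<Rightarrow> 'a::field"
  assumes nz: "x i + y j \<noteq> 0" "x i + y k \<noteq> 0" "x k + y j \<noteq> 0" "x k + y k \<noteq> 0"
    and pivot: "schur x y k k k \<noteq> 0"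
  shows "schur x y (Suc k) i j =
    schur x y k i j - schur x y k i k * schur x y k k j / schur x y k k k"
proof -
  define a where "a i = (\<Prod>l<k. (x i - x l) / (x i + y l))" for i
  define b where "b j = (\<Prod>l<k. (y j - y l) / (x l + y j))" for j
  have split: "schur x y k i j = a i * b j / (x i + y j)" for i j
    unfolding schur_def schur_factor_def a_def b_def prod.distrib[symmetric]
    by (simp add: mult_ac)
  have ab: "a k \<noteq> 0" "b k \<noteq> 0" using pivot unfolding split by auto
  have "schur x y k i k * schur x y k k j / schur x y k k k
      = a i * b j * ((x k + y k) / ((x i + y k) * (x k + y j)))"
    unfolding split using ab nz by (simp add: divide_simps mult_ac)
  \<comment> \<open>Over the common denominator this is \<open>(x i + y k) * (x k + y j) - (x k + y
    k) * (x i + y j) = (x i - x k) * (y j - y k)\<close>.\<close>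
  moreover have "1 / (x i + y j) - (x k + y k) / ((x i + y k) * (x k + y j))
      = 1 / (x i + y j) * schur_factor x y k i j"
    unfolding schur_factor_def using nz by (simp add: divide_simps) (simp add: algebra_simps)
  ultimately show ?thesis unfolding schur_Suc split
    by (metis (no_types, lifting) mult.assoc mult.right_neutral right_diff_distrib times_divide_eq_right)
qed

text \<open>Each summand is the rank-one term removed in one elimination step, so the sum telescopes
  to the original matrix minus the current Schur complement.\<close>

lemma schur_telescope:
  fixes x y :: "nat \<Rightarrow> 'a::field"
  assumes nz: "\<And>i j. i < n \<Longrightarrow> j < n \<Longrightarrow> x i + y j \<noteq> 0"
    and pivot: "\<And>k. k < m \<Longrightarrow> schur x y k k k \<noteq> 0"
    and "m \<le> n" "i < n" "j < n"
  shows "(\<Sum>k<m. schur x y k i k / schur x y k k k * schur x y k k j)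
    = 1 / (x i + y j) - schur x y m i j"
  using assms(2,3)
proof (induction m)
  case 0
  then show ?case by (simp add: schur_0)
next
  case (Suc m)
  then have "schur x y (Suc m) i j =
      schur x y m i j - schur x y m i m * schur x y m m j / schur x y m m m"
    using nz assms by (intro schur_elimination) auto
  with Suc show ?case by simp
qed

text \<open>If all pivots are nonzero, the Schur complements give explicit triangular factors.
  Otherwise two nodes coincide, and with them two rows or columns, so both sides vanish.\<close>

theorem det_cauchy_mat:
  fixes x y :: "nat \<Rightarrow> 'a::field"
  assumes nz: "\<And>i j. i < n \<Longrightarrow> j < n \<Longrightarrow> x i + y j \<noteq> 0"
  shows "det (cauchy_mat n x y) = (\<Prod>k<n. schur x y k k k)"
proof (cases "\<forall>k<n. schur x y k k k \<noteq> 0")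
  case True
  define L where "L = mat n n (\<lambda>(i, k). schur x y k i k / schur x y k k k)"
  define U where "U = mat n n (\<lambda>(k, j). schur x y k k j)"
  have LU: "L \<in> carrier_mat n n" "U \<in> carrier_mat n n" by (auto simp: L_def U_def)
  have "cauchy_mat n x y = L * U"
  proof (rule eq_matI)
    fix i j assume "i < dim_row (L * U)" "j < dim_col (L * U)"
    then have ij: "i < n" "j < n" by (auto simp: L_def U_def)
    have "(L * U) $$ (i, j) = (\<Sum>k<n. schur x y k i k / schur x y k k k * schur x y k k j)"
      using ij by (simp add: L_def U_def scalar_prod_def atLeast0LessThan)
    also have "\<dots> = 1 / (x i + y j) - schur x y n i j"
      using True ij by (intro schur_telescope nz) auto
    finally show "cauchy_mat n x y $$ (i, j) = (L * U) $$ (i, j)"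
      using ij by (simp add: schur_row_zero cauchy_mat_def)
  qed (auto simp: L_def U_def cauchy_mat_def)
  then have "det (cauchy_mat n x y) = det L * det U" using det_mult[OF LU] by simp
  also have "det L = prod_list (diag_mat L)"
    by (rule det_lower_triangular[OF _ LU(1)]) (auto simp: L_def schur_row_zero)
  also have "diag_mat L = map (\<lambda>_. 1) [0..<n]"
    using True by (auto simp: diag_mat_def L_def)
  also have "prod_list (map (\<lambda>_. 1) [0..<n]) = (1::'a)"
    by (induction n) auto
  also have "det U = prod_list (diag_mat U)"
    by (rule det_upper_triangular[OF _ LU(2)]) (auto simp: U_def schur_col_zero)
  also have "diag_mat U = map (\<lambda>k. schur x y k k k) [0..<n]"
    by (auto simp: diag_mat_def U_def)
  finally show ?thesis
    by (simp add: prod.distinct_set_conv_list[symmetric] atLeast0LessThan)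
next
  case False
  then obtain k where k: "k < n" "schur x y k k k = 0" by blast
  then have "\<exists>l<k. schur_factor x y l k k = 0"
    using nz[OF k(1) k(1)] by (auto simp: schur_def)
  then obtain l where l: "l < k" "schur_factor x y l k k = 0" by blast
  \<comment> \<open>By \<open>nz\<close> the denominators are nonzero, so it is the numerator of the
    factor that vanishes.\<close>
  then have "x k = x l \<or> y k = y l"
    using nz[of l k] nz[of k l] k by (auto simp: schur_factor_def)
  then have "det (cauchy_mat n x y) = 0"
  proof
    assume "x k = x l"
    then show ?thesis using k l
      by (intro det_identical_rows[of _ n k l]) (auto simp: cauchy_mat_def intro!: eq_vecI)
  next
    assume "y k = y l"
    then show ?thesis using k l
      by (intro det_identical_columns[of _ n k l]) (auto simp: cauchy_mat_def intro!: eq_vecI)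
  qed
  moreover have "(\<Prod>k<n. schur x y k k k) = 0" using k by (auto simp: prod_zero_iff)
  ultimately show ?thesis by simp
qed

lemma submatrix_cauchy_mat:
  assumes "I \<subseteq> {..<n}" "J \<subseteq> {..<n}" "card J = card I"
  shows "submatrix (cauchy_mat n x y) I J
    = cauchy_mat (card I) (\<lambda>a. x (pick I a)) (\<lambda>a. y (pick J a))"
proof -
  have "{i. i < n \<and> i \<in> I} = I" "{i. i < n \<and> i \<in> J} = J" using assms by auto
  moreover have "pick I a < n" if "a < card I" for a
    using assms that pick_in_set[of a I] by auto
  moreover have "pick J a < n" if "a < card I" for a
    using assms that pick_in_set[of a J] by auto
  ultimately show ?thesis using assms
    by (intro eq_matI) (auto simp: submatrix_def cauchy_mat_def)
qed

section \<open>LU decompositions\<close>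

lemma LU_entry:
  assumes "LU_decomposition n A (L, U)" "i < n" "j < n"
  shows "A $$ (i, j) = (\<Sum>k<n. L $$ (i, k) * U $$ (k, j))"
  using assms by (auto simp: LU_decomposition_def scalar_prod_def atLeast0LessThan)

text \<open>A zero pivot allows the elementary matrices \<open>E 1\<close> and
  \<open>E (-1)\<close>, which are inverse to each other, to be inserted between \<open>L\<close>
  and \<open>U\<close>. The only triangular zero at risk is the entry \<open>(Suc k, k)\<close> of
  \<open>E (-1) * U\<close>, which equals \<open>- U $$ (k, k)\<close>.\<close>

lemma unique_LU_pivot_nonzero:
  fixes A :: "'a::field mat"
  assumes LU: "LU_decomposition n A (L, U)"
    and unique: "\<And>L' U'. LU_decomposition n A (L', U') \<Longrightarrow> L' = L \<and> U' = U"
    and k: "Suc k < n"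
  shows "U $$ (k, k) \<noteq> 0"
proof
  assume zero: "U $$ (k, k) = 0"
  have L: "L \<in> carrier_mat n n" and U: "U \<in> carrier_mat n n" and A: "A = L * U"
    and diag: "\<And>i. i < n \<Longrightarrow> L $$ (i, i) = 1"
    and low: "\<And>i j. i < n \<Longrightarrow> j < n \<Longrightarrow> i < j \<Longrightarrow> L $$ (i, j) = 0"
    and up: "\<And>i j. i < n \<Longrightarrow> j < i \<Longrightarrow> U $$ (i, j) = 0"
    using LU by (auto simp: LU_decomposition_def upper_triangular_def)
  define E :: "'a \<Rightarrow> 'a mat" where
    "E t = mat n n (\<lambda>(i, j). if i = j then 1 else if i = Suc k \<and> j = k then t else 0)" for t
  have E: "E t \<in> carrier_mat n n" for t by (simp add: E_def)
  have LE: "(L * E 1) $$ (i, j) = (if j = k then L $$ (i, k) + L $$ (i, Suc k) else L $$ (i, j))"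
    if "i < n" "j < n" for i j
  proof -
    have "(L * E 1) $$ (i, j) = (\<Sum>l<n. L $$ (i, l) * E 1 $$ (l, j))"
      using that L E[of 1] by (auto simp: scalar_prod_def atLeast0LessThan)
    \<comment> \<open>A column of \<open>E 1\<close> has at most two nonzero entries; writing them
      as two indicator terms lets the sum collapse.\<close>
    also have "\<dots> = (\<Sum>l<n. (if l = j then L $$ (i, j) else 0) +
        (if l = Suc k then (if j = k then L $$ (i, Suc k) else 0) else 0))"
      using that k by (intro sum.cong) (auto simp: E_def)
    finally show ?thesis using that k by (simp add: sum.distrib)
  qed
  have EX: "(E t * X) $$ (i, j) = (if i = Suc k then X $$ (i, j) + t * X $$ (k, j) else X $$ (i, j))"
    if "i < n" "j < n" "X \<in> carrier_mat n n" for i j t X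
  proof -
    have "(E t * X) $$ (i, j) = (\<Sum>l<n. E t $$ (i, l) * X $$ (l, j))"
      using that E[of t] by (auto simp: scalar_prod_def atLeast0LessThan)
    also have "\<dots> = (\<Sum>l<n. (if l = i then X $$ (i, j) else 0) +
        (if l = k then (if i = Suc k then t * X $$ (k, j) else 0) else 0))"
      using that k by (intro sum.cong) (auto simp: E_def)
    finally show ?thesis using that k by (simp add: sum.distrib)
  qed
  have EE: "E 1 * (E (-1) * U) = U"
  proof (rule eq_matI)
    fix i j assume "i < dim_row U" "j < dim_col U"
    then have ij: "i < n" "j < n" using U by auto
    have "E (-1) * U \<in> carrier_mat n n" by (rule mult_carrier_mat[OF E U])
    then show "(E 1 * (E (-1) * U)) $$ (i, j) = U $$ (i, j)"
      using ij U k by (auto simp del: index_mult_mat simp add: EX)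
  qed (use E U in auto)
  have "(L * E 1) * (E (-1) * U) = A"
    using assoc_mult_mat[OF L E[of 1] mult_carrier_mat[OF E[of "-1"] U]] EE A by simp
  moreover have "upper_triangular (E (-1) * U)"
  proof (rule upper_triangularI)
    fix i j assume "j < i" "i < dim_row (E (-1) * U)"
    then have "j < i" "i < n" using E[of "-1"] by auto
    then show "(E (-1) * U) $$ (i, j) = 0"
      using zero up k U by (auto simp del: index_mult_mat simp add: EX less_Suc_eq)
  qed
  ultimately have "LU_decomposition n A (L * E 1, E (-1) * U)"
    using mult_carrier_mat[OF L E[of 1]] mult_carrier_mat[OF E[of "-1"] U] diag low k
    by (auto simp: LU_decomposition_def LE simp del: index_mult_mat(1))
  then have "L * E 1 = L" using unique by blast
  \<comment> \<open>This entry was increased by the diagonal entry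
    \<open>L $$ (Suc k, Suc k) = 1\<close>, so the new factor differs from \<open>L\<close>.\<close>
  then have "(L * E 1) $$ (Suc k, k) = L $$ (Suc k, k)" by simp
  then show False using LE[of "Suc k" k] k diag by simp
qed

text \<open>Subtract from the matrix the first \<open>m\<close> rank-one terms of
  \<open>L * U\<close>. By triangularity, row \<open>m\<close> of the remainder is row
  \<open>m\<close> of \<open>U\<close>, and column \<open>m\<close> is a multiple of column
  \<open>m\<close> of \<open>L\<close>. Induction on \<open>m\<close> identifies the remainder with
  the Schur complement.\<close>

lemma cauchy_LU_entries:
  fixes x y :: "nat \<Rightarrow> 'a::field"
  assumes nz: "\<And>i j. i < n \<Longrightarrow> j < n \<Longrightarrow> x i + y j \<noteq> 0"
    and LU: "LU_decomposition n (cauchy_mat n x y) (L, U)"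
    and unique: "\<And>L' U'. LU_decomposition n (cauchy_mat n x y) (L', U') \<Longrightarrow> L' = L \<and> U' = U"
  shows "\<And>k. Suc k < n \<Longrightarrow> schur x y k k k \<noteq> 0"
    and "\<And>i j. i < n \<Longrightarrow> j < n \<Longrightarrow> U $$ (i, j) = schur x y i i j"
    and "\<And>i j. i < n \<Longrightarrow> j < i \<Longrightarrow> L $$ (i, j) = schur x y j i j / schur x y j j j"
proof -
  have diag: "\<And>i. i < n \<Longrightarrow> L $$ (i, i) = 1"
    and low: "\<And>i j. i < n \<Longrightarrow> j < n \<Longrightarrow> i < j \<Longrightarrow> L $$ (i, j) = 0"
    and up: "\<And>i j. i < n \<Longrightarrow> j < i \<Longrightarrow> U $$ (i, j) = 0"
    using LU by (auto simp: LU_decomposition_def upper_triangular_def)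
  let ?S = "\<lambda>m i j. 1 / (x i + y j) - (\<Sum>l<m. L $$ (i, l) * U $$ (l, j))"
  have entry: "1 / (x i + y j) = (\<Sum>l<n. L $$ (i, l) * U $$ (l, j))" if "i < n" "j < n" for i j
    using LU_entry[OF LU that] that by (simp add: cauchy_mat_def)
  have row: "?S m m j = U $$ (m, j)" if "m < n" "j < n" for m j
  proof -
    have "(\<Sum>l<n. L $$ (m, l) * U $$ (l, j)) = (\<Sum>l<Suc m. L $$ (m, l) * U $$ (l, j))"
      using that low by (intro sum.mono_neutral_right) auto
    then show ?thesis using entry that diag by simp
  qed
  have column: "?S m i m = L $$ (i, m) * U $$ (m, m)" if "m < n" "i < n" for m i
  proof -
    have "(\<Sum>l<n. L $$ (i, l) * U $$ (l, m)) = (\<Sum>l<Suc m. L $$ (i, l) * U $$ (l, m))"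
      using that up by (intro sum.mono_neutral_right) auto
    then show ?thesis using entry that by simp
  qed
  have S: "\<forall>i<n. \<forall>j<n. ?S m i j = schur x y m i j" if "m < n" for m
    using that
  proof (induction m)
    case 0
    then show ?case by (simp add: schur_0)
  next
    case (Suc m)
    have IH: "\<And>i j. i < n \<Longrightarrow> j < n \<Longrightarrow> ?S m i j = schur x y m i j" using Suc by simp
    \<comment> \<open>Here \<open>Suc m < n\<close>, exactly the range in which uniqueness excludes
      a zero pivot; the last pivot may vanish.\<close>
    have pivot: "U $$ (m, m) \<noteq> 0"
      using unique_LU_pivot_nonzero[OF LU unique] Suc.prems by blast
    have Um: "U $$ (m, j) = schur x y m m j" if "j < n" for j
      using row[of m j] IH[of m j] that Suc.prems by simp
    have Lm: "L $$ (i, m) = schur x y m i m / schur x y m m m" if "i < n" for i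
      using column[of m i] IH[of i m] Um[of m] that Suc.prems pivot by (simp add: field_simps)
    show ?case
    proof (intro allI impI)
      fix i j assume ij: "i < n" "j < n"
      have "schur x y (Suc m) i j =
          schur x y m i j - schur x y m i m * schur x y m m j / schur x y m m m"
        using nz ij Suc.prems pivot Um[of m] by (intro schur_elimination) auto
      then show "?S (Suc m) i j = schur x y (Suc m) i j"
        using IH[OF ij] Um[OF ij(2)] Lm[OF ij(1)] by simp
    qed
  qed
  show Uij: "U $$ (i, j) = schur x y i i j" if "i < n" "j < n" for i j
    using row[OF that] S that by simp
  show pivot: "schur x y k k k \<noteq> 0" if "Suc k < n" for k
    using unique_LU_pivot_nonzero[OF LU unique that] Uij[of k k] that by simp
  show "L $$ (i, j) = schur x y j i j / schur x y j j j" if "i < n" "j < i" for i j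
  proof -
    have "schur x y j i j = L $$ (i, j) * schur x y j j j"
      using column[of j i] S[of j] Uij[of j j] that by simp
    then show ?thesis using pivot[of j] that by simp
  qed
qed

section \<open>Running programs\<close>

text \<open>Invariant rule for loops, which also yields termination without abort. The hypothesis
  \<open>bounds\<close> makes the final index of the invariant the upper bound even if the loop body
  is never executed.\<close>

lemma run_For:
  assumes bounds: "ival s lo \<le> ival s hi" and init: "I (ival s lo) s k"
    and step: "\<And>i t l. ival s lo \<le> i \<Longrightarrow> i < ival s hi \<Longrightarrow> I i t l \<Longrightarrow>
      \<exists>t' l'. run \<delta> c (t\<lparr>ivar := (ivar t)(v := i)\<rparr>, l) = Some (t', l') \<and> I (Suc i) t' l'"
  shows "\<exists>t l. run \<delta> (For v lo hi c) (s, k) = Some (t, l) \<and> I (ival s hi) t l"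
proof -
  \<comment> \<open>Bounds are evaluated once, in the initial state. Replacing them by literals
    permits induction on the upper one.\<close>
  have "\<exists>t l. run \<delta> (For v (INum (ival s lo)) (INum m) c) (s, k) = Some (t, l) \<and> I m t l"
    if "ival s lo \<le> m" "m \<le> ival s hi" for m
    using that
  proof (induction m rule: dec_induct)
    case base
    then show ?case using init by simp
  next
    case (step m)
    then obtain t l where t: "run \<delta> (For v (INum (ival s lo)) (INum m) c) (s, k) = Some (t, l)"
      and "I m t l" by auto
    then obtain t' l' where "run \<delta> c (t\<lparr>ivar := (ivar t)(v := m)\<rparr>, l) = Some (t', l')"
      and "I (Suc m) t' l'" using assms(3)[of m t l] step by auto
    then show ?case using t step by simp
  qed
  from this[OF bounds order_refl] show ?thesis by simp
qed

text \<open>The eliminated node has separate index expressions for \<open>x\<close> and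
  \<open>y\<close>, since a minor reads the two through different index vectors.\<close>

definition schur_factor_expr :: "iexp \<Rightarrow> iexp \<Rightarrow> iexp \<Rightarrow> iexp \<Rightarrow> fexp" where
  "schur_factor_expr i l j l' =
    Bin Div
      (Bin Mul (Bin Sub (Elem ''x'' [i]) (Elem ''x'' [l])) (Bin Sub (Elem ''y'' [j]) (Elem ''y'' [l'])))
      (Bin Mul (Bin Add (Elem ''x'' [l]) (Elem ''y'' [j])) (Bin Add (Elem ''x'' [i]) (Elem ''y'' [l'])))"

section \<open>Rounded evaluation measured against exact values\<close>

locale rounding =
  fixes \<delta> :: "nat \<Rightarrow> 'a::real_normed_field" and \<epsilon> :: real
  assumes norm_\<delta>: "norm (\<delta> k) \<le> \<epsilon>" and \<epsilon>_nonneg: "0 \<le> \<epsilon>" and \<epsilon>_less_1: "\<epsilon> < 1"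
begin

text \<open>The factor count \<open>m\<close> is kept apart from the operation counters because
  array entries bring along factors from earlier operations.\<close>

definition evals :: "'a state \<Rightarrow> fexp \<Rightarrow> nat \<Rightarrow> nat \<Rightarrow> 'a \<Rightarrow> nat \<Rightarrow> bool" where
  "evals s e k m v k' \<longleftrightarrow> (\<exists>w. feval \<delta> s e k = Some (w, k') \<and> approx \<epsilon> m v w)"

lemma evals_exact: "feval \<delta> s e k = Some (v, k') \<Longrightarrow> evals s e k 0 v k'"
  unfolding evals_def using approx_refl by blast

lemma evals_Elem:
  "approx \<epsilon> m v (fmem s (a, map (ival s) js)) \<Longrightarrow> evals s (Elem a js) k m v k"
  by (simp add: evals_def)

lemma evals_Mul:
  assumes "evals s e k m u k1" "evals s e' k1 m' v k2"
  shows "evals s (Bin Mul e e') k (Suc (m + m')) (u * v) (Suc k2)"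
  using assms approx_round[OF approx_mult norm_\<delta>] by (fastforce simp: evals_def)

lemma evals_Div:
  assumes "evals s e k m u k1" "evals s e' k1 m' v k2" "v \<noteq> 0"
  shows "evals s (Bin Div e e') k (Suc (m + m')) (u / v) (Suc k2)"
proof -
  obtain u' v' where uv: "feval \<delta> s e k = Some (u', k1)" "approx \<epsilon> m u u'"
    "feval \<delta> s e' k1 = Some (v', k2)" "approx \<epsilon> m' v v'"
    using assms unfolding evals_def by blast
  moreover have "v' \<noteq> 0" using approx_nonzero uv assms \<epsilon>_less_1 by blast
  ultimately show ?thesis
    using approx_round[OF approx_divide[OF uv(2,4)] norm_\<delta>] by (simp add: evals_def)
qed

text \<open>Sums are treated only for operands known exactly: cancellation between approximate
  operands would leave no bound on the relative error.\<close>

lemma evals_Add_Elem: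
  assumes "fmem s (a, map (ival s) js) = u" "fmem s (b, map (ival s) ls) = v"
  shows "evals s (Bin Add (Elem a js) (Elem b ls)) k 1 (u + v) (Suc k)"
  using assms approx_round[OF approx_refl norm_\<delta>] by (simp add: evals_def)

lemma evals_Sub_Elem:
  assumes "fmem s (a, map (ival s) js) = u" "fmem s (b, map (ival s) ls) = v"
  shows "evals s (Bin Sub (Elem a js) (Elem b ls)) k 1 (u - v) (Suc k)"
  using assms approx_round[OF approx_refl norm_\<delta>] by (simp add: evals_def)

lemma evals_schur_factor:
  assumes "fmem s (''x'', [ival s p]) = x i" "fmem s (''x'', [ival s q]) = x l"
    and "fmem s (''y'', [ival s p']) = y j" "fmem s (''y'', [ival s q']) = y l"
    and "x l + y j \<noteq> 0" "x i + y l \<noteq> 0"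
  shows "evals s (schur_factor_expr p q p' q') k 7 (schur_factor x y l i j) (k + 7)"
proof -
  \<comment> \<open>Seven operations: two differences, two sums, two products and one quotient, each
    contributing one factor.\<close>
  have "evals s (schur_factor_expr p q p' q') k
      (Suc (Suc (1 + 1) + Suc (1 + 1))) (schur_factor x y l i j)
      (Suc (Suc (Suc (Suc (Suc (Suc (Suc k)))))))"
    unfolding schur_factor_expr_def schur_factor_def
    by (rule evals_Div[OF evals_Mul[OF evals_Sub_Elem evals_Sub_Elem]
          evals_Mul[OF evals_Add_Elem evals_Add_Elem]]) (use assms in simp_all)
  then show ?thesis by (simp add: numeral_eq_Suc)
qed

lemma run_Assign:
  assumes "evals s e k m v k'"
  obtains w where "run \<delta> (Assign a js e) (s, k) =
      Some (s\<lparr>fmem := (fmem s)((a, map (ival s) js) := w)\<rparr>, k')"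
    and "approx \<epsilon> m v w"
  using assms unfolding evals_def by auto

end

section \<open>Determinants and minors\<close>

text \<open>The maps \<open>f\<close> and \<open>g\<close> turn a loop variable into the index of an
  \<open>x\<close> or \<open>y\<close> node, so one program serves determinants and minors. Each
  pivot is multiplied into the result factor by factor.\<close>

definition pivot_product :: "string \<Rightarrow> (string \<Rightarrow> iexp) \<Rightarrow> (string \<Rightarrow> iexp) \<Rightarrow> com" where
  "pivot_product m f g =
    Seq (Assign ''d'' [] One)
      (For ''k'' (INum 0) (IVar m)
        (Seq
          (Assign ''d'' []
            (Bin Div (Elem ''d'' []) (Bin Add (Elem ''x'' [f ''k'']) (Elem ''y'' [g ''k'']))))
          (For ''l'' (INum 0) (IVar ''k'')
            (Assign ''d'' []
              (Bin Mul (Elem ''d'' []) (schur_factor_expr (f ''k'') (f ''l'') (g ''k'') (g ''l'')))))))"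

text \<open>Every intermediate result is used once, so the factor count of the result equals the
  operation count. The predicate \<open>Ctx\<close> abstracts how the nodes are stored.\<close>

lemma (in rounding) run_pivot_product:
  fixes Ctx :: "'a state \<Rightarrow> bool"
  assumes ivar: "\<And>s v i. Ctx s \<Longrightarrow> v \<in> {''k'', ''l''} \<Longrightarrow> Ctx (s\<lparr>ivar := (ivar s)(v := i)\<rparr>)"
    and fmem: "\<And>s w. Ctx s \<Longrightarrow> Ctx (s\<lparr>fmem := (fmem s)((''d'', []) := w)\<rparr>)"
    and size: "\<And>s. Ctx s \<Longrightarrow> ivar s v = m"
    and x: "\<And>s v. Ctx s \<Longrightarrow> ivar s v < m \<Longrightarrow> fmem s (''x'', [ival s (f v)]) = x (ivar s v)"
    and y: "\<And>s v. Ctx s \<Longrightarrow> ivar s v < m \<Longrightarrow> fmem s (''y'', [ival s (g v)]) = y (ivar s v)"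
    and nz: "\<And>i j. i < m \<Longrightarrow> j < m \<Longrightarrow> x i + y j \<noteq> 0"
    and s: "Ctx s"
  shows "\<exists>t N. run \<delta> (pivot_product v f g) (s, 0) = Some (t, N) \<and> N \<le> 4 * m * m \<and>
    approx \<epsilon> N (det (cauchy_mat m x y)) (fmem t (''d'', []))"
proof -
  let ?P = "\<lambda>i. \<Prod>k<i. schur x y k k k"
  let ?inner = "For ''l'' (INum 0) (IVar ''k'') (Assign ''d'' []
      (Bin Mul (Elem ''d'' []) (schur_factor_expr (f ''k'') (f ''l'') (g ''k'') (g ''l''))))"
  let ?head = "Assign ''d'' []
      (Bin Div (Elem ''d'' []) (Bin Add (Elem ''x'' [f ''k'']) (Elem ''y'' [g ''k''])))"
  \<comment> \<open>Pivot \<open>k\<close> costs \<open>2 + 8 * k\<close> operations, and these sum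
    to \<open>4 * i * i - 2 * i\<close>; the equation is arranged to avoid subtraction on
    naturals.\<close>
  define I where "I i t c \<longleftrightarrow>
      Ctx t \<and> approx \<epsilon> c (?P i) (fmem t (''d'', [])) \<and> c + 2 * i = 4 * i * i" for i t c
  define s1 where "s1 = s\<lparr>fmem := (fmem s)((''d'', []) := 1)\<rparr>"
  have s1: "Ctx s1" "ivar s1 v = m" using fmem s size by (auto simp: s1_def)
  have "\<exists>t c. run \<delta> (For ''k'' (INum 0) (IVar v) (Seq ?head ?inner)) (s1, 0) = Some (t, c) \<and>
      I (ival s1 (IVar v)) t c"
  proof (rule run_For)
    show "I (ival s1 (INum 0)) s1 0"
      using s1 approx_refl by (simp add: I_def) (simp add: s1_def)
  next
    fix i t c assume "i < ival s1 (IVar v)" and It: "I i t c"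
    then have i: "i < m" using s1 by simp
    define t1 where "t1 = t\<lparr>ivar := (ivar t)(''k'' := i)\<rparr>"
    have t1: "Ctx t1" "ivar t1 ''k'' = i" "approx \<epsilon> c (?P i) (fmem t1 (''d'', []))"
      using It ivar by (auto simp: t1_def I_def)
    have "evals t1 (Bin Div (Elem ''d'' []) (Bin Add (Elem ''x'' [f ''k'']) (Elem ''y'' [g ''k''])))
        c (Suc (c + 1)) (?P i / (x i + y i)) (Suc (Suc c))"
      by (rule evals_Div[OF evals_Elem evals_Add_Elem])
        (use t1 i nz x[of t1 "''k''"] y[of t1 "''k''"] in simp_all)
    then obtain w where w: "run \<delta> ?head (t1, c) =
        Some (t1\<lparr>fmem := (fmem t1)((''d'', []) := w)\<rparr>, Suc (Suc c))"
      and aw: "approx \<epsilon> (Suc (c + 1)) (?P i / (x i + y i)) w"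
      by (rule run_Assign[where a = "''d''" and js = "[]"]) simp
    define t2 where "t2 = t1\<lparr>fmem := (fmem t1)((''d'', []) := w)\<rparr>"
    define J where "J l t c' \<longleftrightarrow> Ctx t \<and> ivar t ''k'' = i \<and> c' = c + 2 + 8 * l \<and>
        approx \<epsilon> c' (?P i * schur x y l i i) (fmem t (''d'', []))" for l t c'
    have t2k: "ivar t2 ''k'' = i" using t1 by (simp add: t2_def)
    have "\<exists>t c'. run \<delta> ?inner (t2, Suc (Suc c)) = Some (t, c') \<and> J (ival t2 (IVar ''k'')) t c'"
    proof (rule run_For)
      show "J (ival t2 (INum 0)) t2 (Suc (Suc c))"
        using t1 aw fmem by (simp add: J_def t2_def schur_0)
    next
      fix l u c' assume "l < ival t2 (IVar ''k'')" and Ju: "J l u c'"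
      then have l: "l < i" using t2k by simp
      define u1 where "u1 = u\<lparr>ivar := (ivar u)(''l'' := l)\<rparr>"
      have u1: "Ctx u1" "ivar u1 ''k'' = i" "ivar u1 ''l'' = l"
        "approx \<epsilon> c' (?P i * schur x y l i i) (fmem u1 (''d'', []))"
        using Ju ivar by (auto simp: u1_def J_def)
      have "evals u1 (schur_factor_expr (f ''k'') (f ''l'') (g ''k'') (g ''l'')) c' 7
          (schur_factor x y l i i) (c' + 7)"
        using u1 i l nz x[of u1 "''k''"] y[of u1 "''k''"] x[of u1 "''l''"] y[of u1 "''l''"]
        by (intro evals_schur_factor) auto
      then have "evals u1 (Bin Mul (Elem ''d'' [])
          (schur_factor_expr (f ''k'') (f ''l'') (g ''k'') (g ''l''))) c' (Suc (c' + 7))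
          (?P i * schur x y l i i * schur_factor x y l i i) (Suc (c' + 7))"
        using u1 by (intro evals_Mul) (auto intro: evals_Elem)
      then obtain z where "run \<delta> (Assign ''d'' [] (Bin Mul (Elem ''d'' [])
          (schur_factor_expr (f ''k'') (f ''l'') (g ''k'') (g ''l'')))) (u1, c') =
          Some (u1\<lparr>fmem := (fmem u1)((''d'', []) := z)\<rparr>, Suc (c' + 7))"
        and "approx \<epsilon> (Suc (c' + 7)) (?P i * schur x y l i i * schur_factor x y l i i) z"
        by (rule run_Assign[where a = "''d''" and js = "[]"]) simp
      moreover from this(2)
      have "J (Suc l) (u1\<lparr>fmem := (fmem u1)((''d'', []) := z)\<rparr>) (Suc (c' + 7))"
        using Ju u1 fmem by (simp add: J_def schur_Suc mult.assoc)
      ultimately show "\<exists>t' l'. run \<delta> (Assign ''d'' [] (Bin Mul (Elem ''d'' [])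
          (schur_factor_expr (f ''k'') (f ''l'') (g ''k'') (g ''l''))))
          (u\<lparr>ivar := (ivar u)(''l'' := l)\<rparr>, c') = Some (t', l') \<and> J (Suc l) t' l'"
        unfolding u1_def by blast
    qed simp
    then obtain t3 c3 where t3: "run \<delta> ?inner (t2, Suc (Suc c)) = Some (t3, c3)" "J i t3 c3"
      using t2k by auto
    have "c3 + 2 * Suc i = 4 * Suc i * Suc i"
      using t3(2) It by (simp add: I_def J_def algebra_simps)
    moreover have "approx \<epsilon> c3 (?P (Suc i)) (fmem t3 (''d'', []))"
      using t3(2) by (auto simp: J_def)
    ultimately have "I (Suc i) t3 c3"
      using t3(2) unfolding I_def J_def by blast
    moreover have "run \<delta> (Seq ?head ?inner) (t\<lparr>ivar := (ivar t)(''k'' := i)\<rparr>, c) = Some (t3, c3)"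
      using w t3(1) unfolding t1_def[symmetric] t2_def[symmetric] by (simp del: run.simps(1,3))
    ultimately show "\<exists>t' l'. run \<delta> (Seq ?head ?inner) (t\<lparr>ivar := (ivar t)(''k'' := i)\<rparr>, c) =
        Some (t', l') \<and> I (Suc i) t' l'" by blast
  qed simp
  then obtain t c where t: "run \<delta> (For ''k'' (INum 0) (IVar v) (Seq ?head ?inner)) (s1, 0) =
      Some (t, c)" "I m t c" using s1 by auto
  have "run \<delta> (pivot_product v f g) (s, 0) = Some (t, c)"
    using t(1) by (simp add: pivot_product_def s1_def del: run.simps(3))
  then show ?thesis using t(2) det_cauchy_mat[of m x y] nz by (auto simp: I_def)
qed


text \<open>Turns a count of rounding factors into relative accuracy. A fixed multiple
  \<open>C\<close> of the operation count is allowed, since reused values make factors outnumber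
  operations.\<close>

lemma computes_accuratelyI:
  fixes prob :: "'a::real_normed_field problem"
  assumes "\<And>n s out \<delta> \<epsilon>. (n, s, out) \<in> prob \<Longrightarrow> rounding \<delta> \<epsilon> \<Longrightarrow>
    \<exists>t N. run \<delta> P (s, 0) = Some (t, N) \<and> N \<le> T n \<and>
      (\<forall>(loc, v) \<in> out. approx \<epsilon> (C * N) v (fmem t loc))"
  shows "computes_accurately P T prob"
  unfolding computes_accurately_def
proof (intro allI impI)
  fix \<eta> :: real assume "0 < \<eta> \<and> \<eta> < 1"
  then obtain c where c: "c > 0" "c < 1" and small: "\<And>\<epsilon> k v w. 0 \<le> \<epsilon> \<Longrightarrow> \<epsilon> \<le> c \<Longrightarrow>
    \<epsilon> * real k \<le> c \<Longrightarrow> approx \<epsilon> k v (w::'a) \<Longrightarrow> norm (w - v) \<le> \<eta> * norm v"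
    using approx_small[of \<eta>, where ?'a = 'a] by blast
  \<comment> \<open>With \<open>Suc C\<close> the quotient is defined also for \<open>C = 0\<close>,
    and both \<open>c'\<close> and \<open>c' * C\<close> stay below \<open>c\<close>.\<close>
  define c' where "c' = c / real (Suc C)"
  have c': "c' > 0" "c' \<le> c" "c' * real C \<le> c"
    using c by (auto simp: c'_def field_simps)
  have "\<exists>t N. run \<delta> P (s, 0) = Some (t, N) \<and> N \<le> T n \<and>
      (\<epsilon> * real N \<le> c' \<longrightarrow> (\<forall>(loc, v) \<in> out. norm (fmem t loc - v) \<le> \<eta> * norm v))"
    if inst: "(n, s, out) \<in> prob" and \<epsilon>: "0 \<le> \<epsilon>" "\<epsilon> \<le> c'" "\<And>k. norm (\<delta> k) \<le> \<epsilon>"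
    for n s out \<epsilon> and \<delta> :: "nat \<Rightarrow> 'a"
  proof -
    have "rounding \<delta> \<epsilon>" using \<epsilon> c c' by unfold_locales auto
    from assms[OF inst this] obtain t N where t: "run \<delta> P (s, 0) = Some (t, N)" "N \<le> T n"
      and approx: "\<forall>(loc, v) \<in> out. approx \<epsilon> (C * N) v (fmem t loc)" by blast
    have "norm (fmem t loc - v) \<le> \<eta> * norm v"
      if "\<epsilon> * real N \<le> c'" "(loc, v) \<in> out" for loc v
    proof -
      have "\<epsilon> * real (C * N) \<le> c' * real C"
        using mult_right_mono[OF that(1), of "real C"] by (simp add: mult_ac)
      then show ?thesis using small[of \<epsilon> "C * N" v] \<epsilon> c' approx that(2) by fastforce
    qed
    then show ?thesis using t by blast
  qed
  then show "\<exists>c>0. \<forall>(n, s, out) \<in> prob. \<forall>\<epsilon> \<delta>. 0 \<le> \<epsilon> \<and> \<epsilon> \<le> c \<and> (\<forall>k. norm (\<delta> k) \<le> \<epsilon>) \<longrightarrow>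
      (\<exists>t N. run \<delta> P (s, 0) = Some (t, N) \<and> N \<le> T n \<and>
        (\<epsilon> * real N \<le> c \<longrightarrow> (\<forall>(loc, v) \<in> out. norm (fmem t loc - v) \<le> \<eta> * norm v)))"
    using c'(1) by blast
qed

section \<open>Programs for the determinant and for minors\<close>

definition det_prog :: com where
  "det_prog = pivot_product ''n'' IVar IVar"

definition minor_prog :: com where
  "minor_prog = pivot_product ''m'' (\<lambda>v. IElem ''r'' (IVar v)) (\<lambda>v. IElem ''c'' (IVar v))"

text \<open>The input consists of \<open>2 * n\<close> numbers, and \<open>4 * n * n\<close> is the
  square of that size.\<close>

lemma det_prog_accurate:
  "computes_accurately det_prog (\<lambda>n. poly (monom 1 2) (2 * n))
    (cauchy_det_problem :: 'a::real_normed_field problem)"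
proof (rule computes_accuratelyI[where C = 1])
  fix n out \<epsilon> and \<delta> :: "nat \<Rightarrow> 'a" and s :: "'a state"
  assume "(n, s, out) \<in> cauchy_det_problem" and "rounding \<delta> \<epsilon>"
  then obtain x y where input: "cauchy_input n x y s"
    and out: "out = {((''d'', []), det (cauchy_mat n x y))}"
    by (auto simp: cauchy_det_problem_def)
  interpret rounding \<delta> \<epsilon> by fact
  define Ctx where "Ctx t \<longleftrightarrow> ivar t ''n'' = n \<and>
    (\<forall>i<n. fmem t (''x'', [i]) = x i \<and> fmem t (''y'', [i]) = y i)" for t :: "'a state"
  have "\<exists>t N. run \<delta> det_prog (s, 0) = Some (t, N) \<and> N \<le> 4 * n * n \<and>
      approx \<epsilon> N (det (cauchy_mat n x y)) (fmem t (''d'', []))"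
    unfolding det_prog_def
    by (rule run_pivot_product[where Ctx = Ctx])
      (use input in \<open>auto simp: Ctx_def cauchy_input_def\<close>)
  then show "\<exists>t N. run \<delta> det_prog (s, 0) = Some (t, N) \<and> N \<le> poly (monom 1 2) (2 * n) \<and>
      (\<forall>(loc, v) \<in> out. approx \<epsilon> (1 * N) v (fmem t loc))"
    by (auto simp: out poly_monom power2_eq_square)
qed

lemma minor_prog_accurate:
  "computes_accurately minor_prog (\<lambda>n. poly (monom 1 2) (2 * n))
    (cauchy_minor_problem :: 'a::real_normed_field problem)"
proof (rule computes_accuratelyI[where C = 1])
  fix n out \<epsilon> and \<delta> :: "nat \<Rightarrow> 'a" and s :: "'a state"
  assume "(n, s, out) \<in> cauchy_minor_problem" and "rounding \<delta> \<epsilon>"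
  then obtain x y I J where input: "cauchy_input n x y s"
    and out: "out = {((''d'', []), det (submatrix (cauchy_mat n x y) I J))}"
    and IJ: "I \<subseteq> {..<n}" "J \<subseteq> {..<n}" "card J = card I" and m: "ivar s ''m'' = card I"
    and ivec: "\<forall>a<card I. ivec s ''r'' a = pick I a \<and> ivec s ''c'' a = pick J a"
    by (auto simp: cauchy_minor_problem_def)
  interpret rounding \<delta> \<epsilon> by fact
  have pick: "pick I a < n" "pick J a < n" if "a < card I" for a
    using pick_in_set[of a I] pick_in_set[of a J] IJ that by auto
  define Ctx where "Ctx t \<longleftrightarrow> ivar t ''m'' = card I \<and>
    (\<forall>a<card I. fmem t (''x'', [ivec t ''r'' a]) = x (pick I a) \<and>
      fmem t (''y'', [ivec t ''c'' a]) = y (pick J a))" for t :: "'a state"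
  have "\<exists>t N. run \<delta> minor_prog (s, 0) = Some (t, N) \<and> N \<le> 4 * card I * card I \<and>
      approx \<epsilon> N (det (cauchy_mat (card I) (\<lambda>a. x (pick I a)) (\<lambda>a. y (pick J a))))
        (fmem t (''d'', []))"
    unfolding minor_prog_def
    by (rule run_pivot_product[where Ctx = Ctx])
      (use input m ivec pick in \<open>auto simp: Ctx_def cauchy_input_def\<close>)
  moreover have "4 * card I * card I \<le> 4 * n * n"
    using card_mono[OF _ IJ(1)] by (intro mult_le_mono) auto
  ultimately show "\<exists>t N. run \<delta> minor_prog (s, 0) = Some (t, N) \<and>
      N \<le> poly (monom 1 2) (2 * n) \<and>
      (\<forall>(loc, v) \<in> out. approx \<epsilon> (1 * N) v (fmem t loc))"
    by (fastforce simp: out submatrix_cauchy_mat[OF IJ] poly_monom power2_eq_square)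
qed

section \<open>Gaussian elimination\<close>

text \<open>It reads \<open>A[i,j]\<close> and inputs only, so the multipliers already stored in
  column \<open>k\<close> do not interfere.\<close>

definition schur_update :: fexp where
  "schur_update = Bin Mul (Elem ''A'' [IVar ''i'', IVar ''j''])
    (schur_factor_expr (IVar ''i'') (IVar ''k'') (IVar ''j'') (IVar ''k''))"

text \<open>
  During elimination an entry of the array has seen some number \<open>p\<close> of steps; below the diagonal,
  step \<open>j + 1\<close> of the entry \<open>(i, j)\<close> is the division by the pivot and is its last one.
\<close>

locale cauchy_elimination = rounding \<delta> \<epsilon> for \<delta> :: "nat \<Rightarrow> 'a::real_normed_field" and \<epsilon> +
  fixes n :: nat and x y :: "nat \<Rightarrow> 'a"
  assumes nz: "i < n \<Longrightarrow> j < n \<Longrightarrow> x i + y j \<noteq> 0"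
    and pivot: "Suc k < n \<Longrightarrow> schur x y k k k \<noteq> 0"
begin

definition entry :: "nat \<Rightarrow> nat \<Rightarrow> nat \<Rightarrow> 'a" where
  "entry p i j = (if j < p \<and> j < i then schur x y j i j / schur x y j j j else schur x y p i j)"

text \<open>Forming \<open>1 / (x i + y j)\<close> gives 2 factors and each update 8 more. A
  multiplier is a quotient of two values with \<open>2 + 8 * j\<close> factors each, and the
  division adds one.\<close>

definition roundings :: "nat \<Rightarrow> nat \<Rightarrow> nat \<Rightarrow> nat" where
  "roundings p i j = (if j < p \<and> j < i then 5 + 16 * j else 2 + 8 * p)"

text \<open>Progress \<open>p\<close> is recorded per entry, so that states in the middle of a loop
  can be described as well.\<close>

definition cells :: "(nat \<Rightarrow> nat \<Rightarrow> nat) \<Rightarrow> 'a state \<Rightarrow> bool" where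
  "cells p s \<longleftrightarrow> ivar s ''n'' = n \<and>
    (\<forall>i<n. fmem s (''x'', [i]) = x i \<and> fmem s (''y'', [i]) = y i) \<and>
    (\<forall>i<n. \<forall>j<n. approx \<epsilon> (roundings (p i j) i j) (entry (p i j) i j) (fmem s (''A'', [i, j])))"

text \<open>After \<open>k\<close> outer steps, an entry on or above the diagonal has stopped
  changing after \<open>i\<close> steps, one below it after \<open>Suc j\<close>, the last being the
  division.\<close>

definition stage :: "nat \<Rightarrow> nat \<Rightarrow> nat \<Rightarrow> nat" where
  "stage k i j = min k (if j < i then Suc j else i)"

lemma cells_ivar: "cells p s \<Longrightarrow> v \<noteq> ''n'' \<Longrightarrow> cells p (s\<lparr>ivar := (ivar s)(v := i)\<rparr>)"
  by (simp add: cells_def)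

lemma cells_cong: "cells p s \<Longrightarrow> (\<And>i j. i < n \<Longrightarrow> j < n \<Longrightarrow> p i j = q i j) \<Longrightarrow> cells q s"
  by (simp add: cells_def)

lemma cells_approx:
  assumes "cells p s" "i < n" "j < n"
  shows "approx \<epsilon> (roundings (p i j) i j) (entry (p i j) i j) (fmem s (''A'', [i, j]))"
  using assms by (simp add: cells_def)

lemma cells_update:
  assumes "cells p s" "approx \<epsilon> (roundings (q i j) i j) (entry (q i j) i j) w"
    and "\<And>i' j'. i' < n \<Longrightarrow> j' < n \<Longrightarrow> (i', j') \<noteq> (i, j) \<Longrightarrow> p i' j' = q i' j'"
  shows "cells q (s\<lparr>fmem := (fmem s)((''A'', [i, j]) := w)\<rparr>)"
proof -
  let ?s = "s\<lparr>fmem := (fmem s)((''A'', [i, j]) := w)\<rparr>"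
  have "approx \<epsilon> (roundings (q i' j') i' j') (entry (q i' j') i' j') (fmem ?s (''A'', [i', j']))"
    if "i' < n" "j' < n" for i' j'
  proof (cases "(i', j') = (i, j)")
    case True
    then show ?thesis using assms(2) by simp
  next
    case False
    then show ?thesis using cells_approx[OF assms(1) that] assms(3)[OF that False] by auto
  qed
  then show ?thesis using assms(1) by (simp add: cells_def)
qed

definition column_pos :: "nat \<Rightarrow> nat \<Rightarrow> nat \<Rightarrow> nat \<Rightarrow> nat" where
  "column_pos k i i' j' = (if j' = k \<and> k < i' \<and> i' < i then Suc k else stage k i' j')"

definition block_pos :: "nat \<Rightarrow> nat \<Rightarrow> nat \<Rightarrow> nat \<Rightarrow> nat \<Rightarrow> nat" where
  "block_pos k i j i' j' =
    (if k < i' \<and> (j' = k \<or> k < j' \<and> (i' < i \<or> i' = i \<and> j' < j)) then Suc k else stage k i' j')"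

section \<open>Loops of the elimination and their invariants\<close>

lemma run_column:
  assumes s: "cells (stage k) s" "ivar s ''k'' = k" and k: "k < n"
  shows "\<exists>t c'. run \<delta> (For ''i'' (IAdd (IVar ''k'') (INum 1)) (IVar ''n'')
      (Assign ''A'' [IVar ''i'', IVar ''k'']
        (Bin Div (Elem ''A'' [IVar ''i'', IVar ''k'']) (Elem ''A'' [IVar ''k'', IVar ''k'']))))
      (s, c) = Some (t, c') \<and> cells (block_pos k (Suc k) (Suc k)) t \<and> ivar t ''k'' = k \<and>
      c \<le> c' \<and> c' \<le> c + n"
proof -
  let ?e = "Bin Div (Elem ''A'' [IVar ''i'', IVar ''k'']) (Elem ''A'' [IVar ''k'', IVar ''k''])"
  define I where "I i t c' \<longleftrightarrow> cells (column_pos k i) t \<and> ivar t ''k'' = k \<and> c \<le> c' \<and> c' \<le> c + i"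
    for i t c'
  have n: "ivar s ''n'' = n" using s by (simp add: cells_def)
  have "\<exists>t c'. run \<delta> (For ''i'' (IAdd (IVar ''k'') (INum 1)) (IVar ''n'')
      (Assign ''A'' [IVar ''i'', IVar ''k''] ?e)) (s, c) = Some (t, c') \<and>
      I (ival s (IVar ''n'')) t c'"
  proof (rule run_For)
    show "I (ival s (IAdd (IVar ''k'') (INum 1))) s c"
      using s cells_cong[OF s(1), of "column_pos k (Suc k)"] by (simp add: I_def column_pos_def)
  next
    fix i t c' assume "ival s (IAdd (IVar ''k'') (INum 1)) \<le> i" "i < ival s (IVar ''n'')"
      and It: "I i t c'"
    then have i: "k < i" "i < n" using s n by auto
    define t1 where "t1 = t\<lparr>ivar := (ivar t)(''i'' := i)\<rparr>"
    have t1: "cells (column_pos k i) t1" "ivar t1 ''k'' = k" "ivar t1 ''i'' = i"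
      using It by (auto simp: I_def t1_def cells_ivar)
    have "approx \<epsilon> (2 + 8 * k) (schur x y k i k) (fmem t1 (''A'', [i, k]))"
      "approx \<epsilon> (2 + 8 * k) (schur x y k k k) (fmem t1 (''A'', [k, k]))"
      using cells_approx[OF t1(1), of i k] cells_approx[OF t1(1), of k k] i k
      by (simp_all add: column_pos_def stage_def entry_def roundings_def)
    \<comment> \<open>A row \<open>i\<close> with \<open>k < i < n\<close> exists only if
      \<open>Suc k < n\<close>, so the possibly zero last pivot is never a divisor.\<close>
    then have "evals t1 ?e c' (Suc ((2 + 8 * k) + (2 + 8 * k)))
        (schur x y k i k / schur x y k k k) (Suc c')"
      using pivot i t1 by (intro evals_Div) (auto intro: evals_Elem)
    then obtain w where w: "run \<delta> (Assign ''A'' [IVar ''i'', IVar ''k''] ?e) (t1, c') =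
        Some (t1\<lparr>fmem := (fmem t1)((''A'', [i, k]) := w)\<rparr>, Suc c')"
      and aw: "approx \<epsilon> (Suc ((2 + 8 * k) + (2 + 8 * k))) (schur x y k i k / schur x y k k k) w"
      by (rule run_Assign[where a = "''A''" and js = "[IVar ''i'', IVar ''k'']"])
        (use t1 in \<open>simp del: run.simps feval.simps\<close>)
    have eq: "Suc ((2 + 8 * k) + (2 + 8 * k)) = 5 + 16 * k" by simp
    from aw[unfolded eq] have "cells (column_pos k (Suc i)) (t1\<lparr>fmem := (fmem t1)((''A'', [i, k]) := w)\<rparr>)"
      using i by (intro cells_update[OF t1(1)])
        (auto simp: column_pos_def entry_def roundings_def)
    then show "\<exists>t' l'. run \<delta> (Assign ''A'' [IVar ''i'', IVar ''k''] ?e)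
        (t\<lparr>ivar := (ivar t)(''i'' := i)\<rparr>, c') = Some (t', l') \<and> I (Suc i) t' l'"
      using w t1 It unfolding t1_def[symmetric] by (auto simp: I_def)
  qed (use s n k in simp)
  then obtain t c' where "run \<delta> (For ''i'' (IAdd (IVar ''k'') (INum 1)) (IVar ''n'')
      (Assign ''A'' [IVar ''i'', IVar ''k''] ?e)) (s, c) = Some (t, c')" and It: "I n t c'"
    using n by auto
  moreover have "cells (block_pos k (Suc k) (Suc k)) t"
    by (rule cells_cong[of "column_pos k n"])
      (use It in \<open>auto simp: I_def column_pos_def block_pos_def\<close>)
  ultimately show ?thesis using It unfolding I_def by blast
qed

lemma run_block_row:
  assumes s: "cells (block_pos k i (Suc k)) s" "ivar s ''k'' = k" "ivar s ''i'' = i"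
    and i: "k < i" "i < n"
  shows "\<exists>t c'. run \<delta> (For ''j'' (IAdd (IVar ''k'') (INum 1)) (IVar ''n'')
      (Assign ''A'' [IVar ''i'', IVar ''j''] schur_update)) (s, c) = Some (t, c') \<and>
      cells (block_pos k (Suc i) (Suc k)) t \<and> ivar t ''k'' = k \<and> c \<le> c' \<and> c' \<le> c + 8 * n"
proof -
  \<comment> \<open>The bound \<open>8 * j\<close> also counts the skipped columns up to
    \<open>k\<close>, which avoids an offset.\<close>
  define I where "I j t c' \<longleftrightarrow> cells (block_pos k i j) t \<and> ivar t ''k'' = k \<and> ivar t ''i'' = i \<and>
      c \<le> c' \<and> c' \<le> c + 8 * j" for j t c'
  have n: "ivar s ''n'' = n" using s by (simp add: cells_def)
  have "\<exists>t c'. run \<delta> (For ''j'' (IAdd (IVar ''k'') (INum 1)) (IVar ''n'')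
      (Assign ''A'' [IVar ''i'', IVar ''j''] schur_update)) (s, c) = Some (t, c') \<and>
      I (ival s (IVar ''n'')) t c'"
  proof (rule run_For)
    show "I (ival s (IAdd (IVar ''k'') (INum 1))) s c" using s by (simp add: I_def)
  next
    fix j t c' assume "ival s (IAdd (IVar ''k'') (INum 1)) \<le> j" "j < ival s (IVar ''n'')"
      and It: "I j t c'"
    then have j: "k < j" "j < n" using s n by auto
    define t1 where "t1 = t\<lparr>ivar := (ivar t)(''j'' := j)\<rparr>"
    have t1: "cells (block_pos k i j) t1" "ivar t1 ''k'' = k" "ivar t1 ''i'' = i" "ivar t1 ''j'' = j"
      using It by (auto simp: I_def t1_def cells_ivar)
    have a: "approx \<epsilon> (2 + 8 * k) (schur x y k i j) (fmem t1 (''A'', [i, j]))"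
      using cells_approx[OF t1(1), of i j] i j
      by (simp add: block_pos_def stage_def entry_def roundings_def)
    have "evals t1 (schur_factor_expr (IVar ''i'') (IVar ''k'') (IVar ''j'') (IVar ''k'')) c' 7
        (schur_factor x y k i j) (c' + 7)"
      using t1 i j nz by (intro evals_schur_factor) (auto simp: cells_def)
    then have "evals t1 schur_update c' (Suc ((2 + 8 * k) + 7))
        (schur x y k i j * schur_factor x y k i j) (Suc (c' + 7))"
      unfolding schur_update_def using a t1 by (intro evals_Mul) (auto intro: evals_Elem)
    then obtain w where w: "run \<delta> (Assign ''A'' [IVar ''i'', IVar ''j''] schur_update) (t1, c') =
        Some (t1\<lparr>fmem := (fmem t1)((''A'', [i, j]) := w)\<rparr>, Suc (c' + 7))"
      and aw: "approx \<epsilon> (Suc ((2 + 8 * k) + 7)) (schur x y (Suc k) i j) w"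
      by (rule run_Assign[where a = "''A''" and js = "[IVar ''i'', IVar ''j'']"])
        (use t1 in \<open>simp add: schur_Suc del: run.simps feval.simps\<close>)
    have eq: "Suc ((2 + 8 * k) + 7) = 2 + 8 * Suc k" by simp
    from aw[unfolded eq] have "cells (block_pos k i (Suc j)) (t1\<lparr>fmem := (fmem t1)((''A'', [i, j]) := w)\<rparr>)"
      using i j by (intro cells_update[OF t1(1)])
        (auto simp: block_pos_def entry_def roundings_def)
    then show "\<exists>t' l'. run \<delta> (Assign ''A'' [IVar ''i'', IVar ''j''] schur_update)
        (t\<lparr>ivar := (ivar t)(''j'' := j)\<rparr>, c') = Some (t', l') \<and> I (Suc j) t' l'"
      using w t1 It unfolding t1_def[symmetric] by (auto simp: I_def)
  qed (use s n i in simp)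
  then obtain t c' where "run \<delta> (For ''j'' (IAdd (IVar ''k'') (INum 1)) (IVar ''n'')
      (Assign ''A'' [IVar ''i'', IVar ''j''] schur_update)) (s, c) = Some (t, c')" and It: "I n t c'"
    using n by auto
  moreover have "cells (block_pos k (Suc i) (Suc k)) t"
    by (rule cells_cong[of "block_pos k i n"]) (use It in \<open>auto simp: I_def block_pos_def\<close>)
  ultimately show ?thesis using It unfolding I_def by blast
qed

lemma run_block:
  assumes s: "cells (block_pos k (Suc k) (Suc k)) s" "ivar s ''k'' = k" and k: "k < n"
  shows "\<exists>t c'. run \<delta> (For ''i'' (IAdd (IVar ''k'') (INum 1)) (IVar ''n'')
      (For ''j'' (IAdd (IVar ''k'') (INum 1)) (IVar ''n'')
        (Assign ''A'' [IVar ''i'', IVar ''j''] schur_update))) (s, c) = Some (t, c') \<and>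
      cells (stage (Suc k)) t \<and> c \<le> c' \<and> c' \<le> c + 8 * n * n"
proof -
  let ?row = "For ''j'' (IAdd (IVar ''k'') (INum 1)) (IVar ''n'')
        (Assign ''A'' [IVar ''i'', IVar ''j''] schur_update)"
  define I where "I i t c' \<longleftrightarrow> cells (block_pos k i (Suc k)) t \<and> ivar t ''k'' = k \<and>
      c \<le> c' \<and> c' \<le> c + 8 * n * i" for i t c'
  have n: "ivar s ''n'' = n" using s by (simp add: cells_def)
  have "\<exists>t c'. run \<delta> (For ''i'' (IAdd (IVar ''k'') (INum 1)) (IVar ''n'') ?row) (s, c) =
      Some (t, c') \<and> I (ival s (IVar ''n'')) t c'"
  proof (rule run_For)
    show "I (ival s (IAdd (IVar ''k'') (INum 1))) s c" using s by (simp add: I_def)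
  next
    fix i t c' assume "ival s (IAdd (IVar ''k'') (INum 1)) \<le> i" "i < ival s (IVar ''n'')"
      and It: "I i t c'"
    then have "k < i" "i < n" using s n by auto
    then have "\<exists>t' l'. run \<delta> ?row (t\<lparr>ivar := (ivar t)(''i'' := i)\<rparr>, c') = Some (t', l') \<and>
        cells (block_pos k (Suc i) (Suc k)) t' \<and> ivar t' ''k'' = k \<and> c' \<le> l' \<and> l' \<le> c' + 8 * n"
      using It by (intro run_block_row) (auto simp: I_def cells_ivar)
    then show "\<exists>t' l'. run \<delta> ?row (t\<lparr>ivar := (ivar t)(''i'' := i)\<rparr>, c') = Some (t', l') \<and>
        I (Suc i) t' l'"
      using It unfolding I_def by fastforce
  qed (use s n k in simp)
  then obtain t c' where "run \<delta> (For ''i'' (IAdd (IVar ''k'') (INum 1)) (IVar ''n'') ?row) (s, c) =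
      Some (t, c')" and It: "I n t c'"
    using n by auto
  \<comment> \<open>Rows up to \<open>k\<close> and columns before \<open>k\<close> have already
    reached their cap in \<open>stage\<close>; all other entries have just moved to
    \<open>Suc k\<close>.\<close>
  moreover have "cells (stage (Suc k)) t"
    by (rule cells_cong[of "block_pos k n (Suc k)"])
      (use It in \<open>auto simp: I_def block_pos_def stage_def\<close>)
  ultimately show ?thesis using It unfolding I_def by blast
qed

lemma run_form_cauchy:
  assumes s: "ivar s ''n'' = n" "\<And>i. i < n \<Longrightarrow> fmem s (''x'', [i]) = x i \<and> fmem s (''y'', [i]) = y i"
  shows "\<exists>t. run \<delta> (For ''i'' (INum 0) (IVar ''n'') (For ''j'' (INum 0) (IVar ''n'')
      (Assign ''A'' [IVar ''i'', IVar ''j'']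
        (Bin Div One (Bin Add (Elem ''x'' [IVar ''i'']) (Elem ''y'' [IVar ''j'']))))))
      (s, 0) = Some (t, 2 * n * n) \<and> cells (stage 0) t"
proof -
  let ?assign = "Assign ''A'' [IVar ''i'', IVar ''j'']
        (Bin Div One (Bin Add (Elem ''x'' [IVar ''i'']) (Elem ''y'' [IVar ''j''])))"
  let ?row = "For ''j'' (INum 0) (IVar ''n'') ?assign"
  \<comment> \<open>The array is initially arbitrary, so \<open>cells\<close> cannot hold yet;
    \<open>S\<close> collects the positions already formed.\<close>
  define F where "F S t \<longleftrightarrow> ivar t ''n'' = n \<and>
    (\<forall>i<n. fmem t (''x'', [i]) = x i \<and> fmem t (''y'', [i]) = y i) \<and>
    (\<forall>(i, j) \<in> S. approx \<epsilon> 2 (schur x y 0 i j) (fmem t (''A'', [i, j])))"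
    for S and t :: "'a state"
  define I where "I i t c \<longleftrightarrow> F ({..<i} \<times> {..<n}) t \<and> c = 2 * n * i" for i t c
  have "\<exists>t c. run \<delta> (For ''i'' (INum 0) (IVar ''n'') ?row) (s, 0) = Some (t, c) \<and>
      I (ival s (IVar ''n'')) t c"
  proof (rule run_For)
    show "I (ival s (INum 0)) s 0" using s by (simp add: I_def F_def)
  next
    fix i t c assume "i < ival s (IVar ''n'')" and It: "I i t c"
    then have i: "i < n" using s by simp
    define t1 where "t1 = t\<lparr>ivar := (ivar t)(''i'' := i)\<rparr>"
    define J where "J j u c' \<longleftrightarrow> F ({..<i} \<times> {..<n} \<union> {i} \<times> {..<j}) u \<and> ivar u ''i'' = i \<and>
        c' = c + 2 * j" for j u c'
    have n: "ivar t1 ''n'' = n" using It by (simp add: I_def F_def t1_def)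
    have "\<exists>u c'. run \<delta> ?row (t1, c) = Some (u, c') \<and> J (ival t1 (IVar ''n'')) u c'"
    proof (rule run_For)
      show "J (ival t1 (INum 0)) t1 c" using It by (simp add: I_def J_def F_def t1_def)
    next
      fix j u c' assume "j < ival t1 (IVar ''n'')" and Ju: "J j u c'"
      then have j: "j < n" using n by simp
      define u1 where "u1 = u\<lparr>ivar := (ivar u)(''j'' := j)\<rparr>"
      have u1: "F ({..<i} \<times> {..<n} \<union> {i} \<times> {..<j}) u1" "ivar u1 ''i'' = i" "ivar u1 ''j'' = j"
        using Ju by (auto simp: J_def F_def u1_def)
      have "evals u1 (Bin Div One (Bin Add (Elem ''x'' [IVar ''i'']) (Elem ''y'' [IVar ''j''])))
          c' (Suc (0 + 1)) (1 / (x i + y j)) (Suc (Suc c'))"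
        by (rule evals_Div[OF evals_exact evals_Add_Elem]) (use u1 i j nz in \<open>auto simp: F_def\<close>)
      then obtain w where w: "run \<delta> ?assign (u1, c') =
          Some (u1\<lparr>fmem := (fmem u1)((''A'', [i, j]) := w)\<rparr>, Suc (Suc c'))"
        and aw: "approx \<epsilon> (Suc (0 + 1)) (schur x y 0 i j) w"
        by (rule run_Assign[where a = "''A''" and js = "[IVar ''i'', IVar ''j'']"])
          (use u1 in \<open>simp add: schur_0 del: run.simps feval.simps\<close>)
      have eq: "Suc (0 + 1) = 2" by simp
      from aw[unfolded eq] have "F ({..<i} \<times> {..<n} \<union> {i} \<times> {..<Suc j})
          (u1\<lparr>fmem := (fmem u1)((''A'', [i, j]) := w)\<rparr>)"
        using u1(1) by (auto simp: F_def less_Suc_eq)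
      then show "\<exists>t' l'. run \<delta> ?assign (u\<lparr>ivar := (ivar u)(''j'' := j)\<rparr>, c') = Some (t', l') \<and>
          J (Suc j) t' l'"
        using w u1 Ju unfolding u1_def[symmetric] by (auto simp: J_def)
    qed simp
    then obtain u where "run \<delta> ?row (t1, c) = Some (u, c + 2 * n)"
      and "F ({..<i} \<times> {..<n} \<union> {i} \<times> {..<n}) u" using n by (auto simp: J_def)
    moreover have "{..<i} \<times> {..<n} \<union> {i} \<times> {..<n} = {..<Suc i} \<times> {..<n}" by auto
    ultimately show "\<exists>t' l'. run \<delta> ?row (t\<lparr>ivar := (ivar t)(''i'' := i)\<rparr>, c) = Some (t', l') \<and>
        I (Suc i) t' l'"
      using It unfolding t1_def[symmetric] by (auto simp: I_def)
  qed simp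
  then show ?thesis using s by (auto simp: I_def F_def cells_def stage_def entry_def roundings_def)
qed

text \<open>The lower bound on \<open>N\<close> serves to dominate the factor counts of the entries
  by a multiple of the operation count.\<close>

lemma run_gauss_elim:
  assumes s: "ivar s ''n'' = n" "\<And>i. i < n \<Longrightarrow> fmem s (''x'', [i]) = x i \<and> fmem s (''y'', [i]) = y i"
  shows "\<exists>t N. run \<delta> (gauss_elim schur_update) (s, 0) = Some (t, N) \<and> cells (stage n) t \<and>
    2 * n * n \<le> N \<and> N \<le> 2 * n * n + (n + 8 * n * n) * n"
proof -
  let ?form = "For ''i'' (INum 0) (IVar ''n'') (For ''j'' (INum 0) (IVar ''n'')
      (Assign ''A'' [IVar ''i'', IVar ''j'']
        (Bin Div One (Bin Add (Elem ''x'' [IVar ''i'']) (Elem ''y'' [IVar ''j''])))))"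
  let ?column = "For ''i'' (IAdd (IVar ''k'') (INum 1)) (IVar ''n'')
      (Assign ''A'' [IVar ''i'', IVar ''k'']
        (Bin Div (Elem ''A'' [IVar ''i'', IVar ''k'']) (Elem ''A'' [IVar ''k'', IVar ''k''])))"
  let ?block = "For ''i'' (IAdd (IVar ''k'') (INum 1)) (IVar ''n'')
      (For ''j'' (IAdd (IVar ''k'') (INum 1)) (IVar ''n'')
        (Assign ''A'' [IVar ''i'', IVar ''j''] schur_update))"
  obtain s1 where s1: "run \<delta> ?form (s, 0) = Some (s1, 2 * n * n)" "cells (stage 0) s1"
    using run_form_cauchy[OF s] by blast
  have n: "ivar s1 ''n'' = n" using s1 by (simp add: cells_def)
  define I where "I k t c \<longleftrightarrow> cells (stage k) t \<and> 2 * n * n \<le> c \<and>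
      c \<le> 2 * n * n + (n + 8 * n * n) * k" for k t c
  have "\<exists>t c. run \<delta> (For ''k'' (INum 0) (IVar ''n'') (Seq ?column ?block)) (s1, 2 * n * n) =
      Some (t, c) \<and> I (ival s1 (IVar ''n'')) t c"
  proof (rule run_For)
    show "I (ival s1 (INum 0)) s1 (2 * n * n)" using s1 by (simp add: I_def)
  next
    fix k t c assume "k < ival s1 (IVar ''n'')" and It: "I k t c"
    then have k: "k < n" using n by simp
    define t1 where "t1 = t\<lparr>ivar := (ivar t)(''k'' := k)\<rparr>"
    have t1: "cells (stage k) t1" "ivar t1 ''k'' = k"
      using It by (auto simp: I_def t1_def cells_ivar)
    obtain t2 c2 where t2: "run \<delta> ?column (t1, c) = Some (t2, c2)"
      "cells (block_pos k (Suc k) (Suc k)) t2" "ivar t2 ''k'' = k" "c \<le> c2" "c2 \<le> c + n"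
      using run_column[OF t1 k] by blast
    obtain t3 c3 where t3: "run \<delta> ?block (t2, c2) = Some (t3, c3)"
      "cells (stage (Suc k)) t3" "c2 \<le> c3" "c3 \<le> c2 + 8 * n * n"
      using run_block[OF t2(2,3) k] by blast
    have "run \<delta> (Seq ?column ?block) (t1, c) = Some (t3, c3)"
      using t2(1) t3(1) by (simp del: run.simps(1,3))
    moreover have "I (Suc k) t3 c3" using It t2 t3 by (simp add: I_def)
    ultimately show "\<exists>t' l'. run \<delta> (Seq ?column ?block) (t\<lparr>ivar := (ivar t)(''k'' := k)\<rparr>, c) =
        Some (t', l') \<and> I (Suc k) t' l'"
      unfolding t1_def by blast
  qed simp
  then obtain t c where t: "run \<delta> (For ''k'' (INum 0) (IVar ''n'') (Seq ?column ?block))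
      (s1, 2 * n * n) = Some (t, c)" "I n t c"
    using n by auto
  have "run \<delta> (gauss_elim schur_update) (s, 0) = Some (t, c)"
    using s1(1) t(1) by (simp add: gauss_elim_def Let_def del: run.simps(1,3))
  then show ?thesis using t(2) by (simp add: I_def)
qed

end

lemma gauss_elim_accurate:
  "computes_accurately (gauss_elim schur_update) (\<lambda>n. 2 * n * n + (n + 8 * n * n) * n)
    (cauchy_LU_problem :: 'a::real_normed_field problem)"
proof (rule computes_accuratelyI[where C = 21])
  fix n out \<epsilon> and \<delta> :: "nat \<Rightarrow> 'a" and s :: "'a state"
  assume "(n, s, out) \<in> cauchy_LU_problem" and "rounding \<delta> \<epsilon>"
  then obtain x y L U where input: "cauchy_input n x y s"
    and out: "out = {((''A'', [i, j]), if j < i then L $$ (i, j) else U $$ (i, j)) |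
      i j. i < n \<and> j < n}"
    and LU: "LU_decomposition n (cauchy_mat n x y) (L, U)"
    and unique: "\<And>L' U'. LU_decomposition n (cauchy_mat n x y) (L', U') \<Longrightarrow> L' = L \<and> U' = U"
    by (auto simp: cauchy_LU_problem_def)
  interpret rounding \<delta> \<epsilon> by fact
  have nz: "x i + y j \<noteq> 0" if "i < n" "j < n" for i j
    using input that by (simp add: cauchy_input_def)
  note entries = cauchy_LU_entries[OF nz LU unique]
  interpret cauchy_elimination \<delta> \<epsilon> n x y
    using nz entries(1) by unfold_locales auto
  obtain t N where t: "run \<delta> (gauss_elim schur_update) (s, 0) = Some (t, N)" "cells (stage n) t"
    "2 * n * n \<le> N" "N \<le> 2 * n * n + (n + 8 * n * n) * n"
    using run_gauss_elim[of s] input by (auto simp: cauchy_input_def)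
  have cell: "approx \<epsilon> (21 * N) (if j < i then L $$ (i, j) else U $$ (i, j)) (fmem t (''A'', [i, j]))"
    if ij: "i < n" "j < n" for i j
  proof -
    have "2 * n * 1 \<le> 2 * n * n" using ij by (intro mult_le_mono2) auto
    then have "2 * n \<le> N" using t(3) by linarith
    \<comment> \<open>The constant is \<open>5 + 16\<close>: for \<open>i, j < n\<close> both
      \<open>5 + 16 * j\<close> and \<open>2 + 8 * i\<close> are at most
      \<open>21 * n\<close>.\<close>
    then have "roundings (stage n i j) i j \<le> 21 * N"
      using ij t(3) by (auto simp: roundings_def stage_def)
    moreover have "entry (stage n i j) i j = (if j < i then L $$ (i, j) else U $$ (i, j))"
      using entries(2,3) ij by (auto simp: entry_def stage_def)
    ultimately show ?thesis
      using approx_mono[OF cells_approx[OF t(2) ij] _ \<epsilon>_nonneg] by metis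
  qed
  have "approx \<epsilon> (21 * N) v (fmem t loc)" if "(loc, v) \<in> out" for loc v
    using that cell unfolding out by blast
  then show "\<exists>t N. run \<delta> (gauss_elim schur_update) (s, 0) = Some (t, N) \<and>
      N \<le> 2 * n * n + (n + 8 * n * n) * n \<and>
      (\<forall>(loc, v) \<in> out. approx \<epsilon> (21 * N) v (fmem t loc))"
    using t(1,4) by blast
qed

lemma gauss_elim_cost: "(\<lambda>n. real (2 * n * n + (n + 8 * n * n) * n)) \<in> O(\<lambda>n. real n ^ 3)"
proof (rule bigoI[where c = 11], rule always_eventually, rule allI)
  fix n :: nat
  \<comment> \<open>Absorbs the quadratic part \<open>3 * n * n\<close> into the cubic one, giving
    \<open>8 + 3 = 11\<close>.\<close>
  have "n * n \<le> n * n * n" by (cases n) auto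
  then have "2 * n * n + (n + 8 * n * n) * n \<le> 11 * n ^ 3"
    by (simp add: power3_eq_cube algebra_simps)
  then have "real (2 * n * n + (n + 8 * n * n) * n) \<le> real (11 * n ^ 3)"
    using of_nat_le_iff by blast
  then show "norm (real (2 * n * n + (n + 8 * n * n) * n)) \<le> 11 * norm (real n ^ 3)" by simp
qed

theorem mainTheorem4:
  shows
    "(\<exists>P. \<exists>p :: nat poly.
        computes_accurately P (\<lambda>n. poly p (2 * n)) (cauchy_det_problem :: real problem) \<and>
        computes_accurately P (\<lambda>n. poly p (2 * n)) (cauchy_det_problem :: complex problem))
   \<and> (\<exists>P. \<exists>p :: nat poly.
        computes_accurately P (\<lambda>n. poly p (2 * n)) (cauchy_minor_problem :: real problem) \<and>
        computes_accurately P (\<lambda>n. poly p (2 * n)) (cauchy_minor_problem :: complex problem))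
   \<and> (\<exists>upd. \<exists>T :: nat \<Rightarrow> nat.
        (\<lambda>n. real (T n)) \<in> O(\<lambda>n. real n ^ 3) \<and>
        computes_accurately (gauss_elim upd) T (cauchy_LU_problem :: real problem) \<and>
        computes_accurately (gauss_elim upd) T (cauchy_LU_problem :: complex problem))"
  \<comment> \<open>The accuracy lemmas are polymorphic in the normed field, so the same witnesses
    serve the real and the complex case.\<close>
  by (rule conjI, rule exI[of _ det_prog], rule exI[of _ "monom 1 2"],
      intro conjI det_prog_accurate,
      rule conjI, rule exI[of _ minor_prog], rule exI[of _ "monom 1 2"],
      intro conjI minor_prog_accurate,
      rule exI[of _ schur_update], rule exI[of _ "\<lambda>n. 2 * n * n + (n + 8 * n * n) * n"],
      intro conjI gauss_elim_cost gauss_elim_accurate)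

end
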